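(* There exist universal constants $c,C>0$ such that the following holds for all integers $1\le k<n$ and all $t\ge 0$. Let $(\sigma_t)_{t\ge0}$ be the interchange process on the complete graph $K_n$ started from the identity, let $s_k(t)$ be the number of cycles of size $k$ of $\sigma_t$, and let $t_{n,k}$ be the unique real number such that $e^{-k t_{n,k}}=(n-k)/(n-1)$. Then $$\left|\mathbb{E}(s_k(t))-\frac1k\mathbf{1}_{\{t>t_{n,k}\}}\right|\le C\,q\,\exp\left\{-c\,(n-k)\min\{|t-t_{n,k}|^2k^2,\,1\}\right\},$$ where $q=q_n(k)=n^{3/2}k^{-3/2}(n-k)^{-1/2}$.
   Context: The interchange process on $K_n$ is the continuous-time random walk $(\sigma_t)_{t\ge0}$ on the symmetric group $S_n$, with $\sigma_0=\mathrm{id}$, in which each of the $\binom n2$ transpositions $(i,j)$, $1\le i<j\le n$, is applied (multiplied to the current permutation) at rate $1$, independently. Equivalently, its generator, viewed as an element of the group algebra $\mathbb{C}[S_n]$, is $Q=\sum_{i<j}[(i,j)-\mathrm{id}]$, and $\mathbb{P}(\sigma_t=s)$ is the coefficient of $s$ in $e^{tQ}$. Fixed points count as cycles of size $1$. *)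

theory Defs
  imports "HOL-Probability.Probability" "HOL-Combinatorics.Combinatorics"
begin

subsection \<open>The group algebra of the symmetric group\<close>

definition sym_grp :: "nat \<Rightarrow> (nat \<Rightarrow> nat) set" where
  "sym_grp n = {p. p permutes {1..n}}"

text \<open>An element of the group algebra is given by its coefficient function; it is meant to
  vanish outside \<^term>\<open>sym_grp n\<close>. The permutation \<open>u \<circ> v\<close> is the product of \<open>u\<close> and \<open>v\<close>.\<close>

type_synonym galg = "(nat \<Rightarrow> nat) \<Rightarrow> complex"

definition ga_of :: "(nat \<Rightarrow> nat) \<Rightarrow> galg" where
  "ga_of u = (\<lambda>s. of_bool (s = u))"

definition ga_mult :: "nat \<Rightarrow> galg \<Rightarrow> galg \<Rightarrow> galg" where
  "ga_mult n a b = (\<lambda>s. \<Sum>u\<in>sym_grp n. a u * b (inv u \<circ> s))"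

primrec ga_power :: "nat \<Rightarrow> galg \<Rightarrow> nat \<Rightarrow> galg" where
  "ga_power n a 0 = ga_of id"
| "ga_power n a (Suc m) = ga_mult n a (ga_power n a m)"

definition ga_exp :: "nat \<Rightarrow> galg \<Rightarrow> galg" where
  "ga_exp n a = (\<lambda>s. \<Sum>m. ga_power n a m s / fact m)"


subsection \<open>The interchange process on the complete graph\<close>

definition edges :: "nat \<Rightarrow> (nat \<times> nat) set" where
  "edges n = {(i, j). 1 \<le> i \<and> i < j \<and> j \<le> n}"

definition interchange_gen :: "nat \<Rightarrow> galg" where
  "interchange_gen n = (\<lambda>s. \<Sum>(i, j)\<in>edges n. ga_of (Transposition.transpose i j) s - ga_of id s)"

text \<open>The law at time \<open>t\<close> of the process started from the identity. That the coefficients below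
  are real, nonnegative and of total mass one is proved in \<open>pmf_interchange_law\<close>.\<close>

definition interchange_law :: "nat \<Rightarrow> real \<Rightarrow> (nat \<Rightarrow> nat) pmf" where
  "interchange_law n t =
     embed_pmf (\<lambda>s. Re (ga_exp n (\<lambda>u. complex_of_real t * interchange_gen n u) s))"

definition cycle_count :: "nat \<Rightarrow> nat \<Rightarrow> (nat \<Rightarrow> nat) \<Rightarrow> nat" where
  "cycle_count n k p = card {c \<in> orbit p ` {1..n}. card c = k}"

definition crit_time :: "nat \<Rightarrow> nat \<Rightarrow> real" where
  "crit_time n k = (THE t. exp (- (real k * t)) = (real n - real k) / (real n - 1))"

lemma crit_time_unique:
  assumes "1 \<le> k" "k < n"
  shows "\<exists>!t. exp (- (real k * t)) = (real n - real k) / (real n - 1)"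
proof
  let ?r = "(real n - real k) / (real n - 1)"
  have r: "?r > 0" using assms by simp
  show "exp (- (real k * (- ln ?r / real k))) = ?r"
    using assms exp_ln[OF r] by simp
  fix t assume "exp (- (real k * t)) = ?r"
  then have "- (real k * t) = ln ?r" by (metis ln_exp)
  then show "t = - ln ?r / real k" using assms by (simp add: field_simps)
qed

lemma exp_crit_time:
  assumes "1 \<le> k" "k < n"
  shows "exp (- (real k * crit_time n k)) = (real n - real k) / (real n - 1)"
  unfolding crit_time_def using theI'[OF crit_time_unique[OF assms]] .


subsection \<open>Well-definedness of the law\<close>

lemma finite_sym_grp: "finite (sym_grp n)"
  by (simp add: sym_grp_def finite_permutations)

lemma finite_edges: "finite (edges n)"
  by (rule finite_subset[of _ "{1..n} \<times> {1..n}"]) (auto simp: edges_def)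

lemma transpose_in_sym_grp: "(i, j) \<in> edges n \<Longrightarrow> Transposition.transpose i j \<in> sym_grp n"
  by (auto simp: edges_def sym_grp_def intro: permutes_swap_id)

lemma id_in_sym_grp: "id \<in> sym_grp n"
  by (simp add: sym_grp_def permutes_id)

lemma transpose_comp_in_sym_grp:
  assumes "(i, j) \<in> edges n"
  shows "Transposition.transpose i j \<circ> s \<in> sym_grp n \<longleftrightarrow> s \<in> sym_grp n"
proof
  assume "Transposition.transpose i j \<circ> s \<in> sym_grp n"
  then have "Transposition.transpose i j \<circ> (Transposition.transpose i j \<circ> s) \<in> sym_grp n"
    using transpose_in_sym_grp[OF assms] by (auto simp: sym_grp_def intro: permutes_compose)
  then show "s \<in> sym_grp n" by (simp add: comp_assoc[symmetric])
next
  assume "s \<in> sym_grp n"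
  then show "Transposition.transpose i j \<circ> s \<in> sym_grp n"
    using transpose_in_sym_grp[OF assms] by (auto simp: sym_grp_def intro: permutes_compose)
qed

lemma ga_mult_interchange_gen:
  "ga_mult n (\<lambda>u. c * interchange_gen n u) b s =
     c * ((\<Sum>(i, j)\<in>edges n. b (Transposition.transpose i j \<circ> s)) - of_nat (card (edges n)) * b s)"
proof -
  have *: "(\<Sum>u\<in>sym_grp n. ga_of v u * b (inv u \<circ> s)) = b (inv v \<circ> s)"
    if "v \<in> sym_grp n" for v
    using that finite_sym_grp by (simp add: ga_of_def of_bool_def if_distrib[of "\<lambda>x. x * _"] cong: if_cong)
  have "ga_mult n (\<lambda>u. c * interchange_gen n u) b s =
      (\<Sum>u\<in>sym_grp n. \<Sum>e\<in>edges n.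
         c * (ga_of (Transposition.transpose (fst e) (snd e)) u * b (inv u \<circ> s) - ga_of id u * b (inv u \<circ> s)))"
    by (simp add: ga_mult_def interchange_gen_def sum_distrib_left sum_distrib_right
        case_prod_unfold algebra_simps)
  also have "\<dots> = (\<Sum>e\<in>edges n. \<Sum>u\<in>sym_grp n.
         c * (ga_of (Transposition.transpose (fst e) (snd e)) u * b (inv u \<circ> s) - ga_of id u * b (inv u \<circ> s)))"
    by (rule sum.swap)
  also have "\<dots> = (\<Sum>e\<in>edges n. c * (b (Transposition.transpose (fst e) (snd e) \<circ> s) - b s))"
  proof (rule sum.cong[OF refl])
    fix e assume e: "e \<in> edges n"
    then have t: "Transposition.transpose (fst e) (snd e) \<in> sym_grp n"
      using transpose_in_sym_grp[of "fst e" "snd e"] by simp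
    show "(\<Sum>u\<in>sym_grp n. c * (ga_of (Transposition.transpose (fst e) (snd e)) u * b (inv u \<circ> s)
             - ga_of id u * b (inv u \<circ> s))) = c * (b (Transposition.transpose (fst e) (snd e) \<circ> s) - b s)"
      by (simp only: sum_distrib_left[symmetric] sum_subtractf *[OF t] *[OF id_in_sym_grp]
          inv_transpose_eq inv_id id_comp)
  qed
  also have "\<dots> = c * ((\<Sum>(i, j)\<in>edges n. b (Transposition.transpose i j \<circ> s)) - of_nat (card (edges n)) * b s)"
    by (simp add: sum_distrib_left[symmetric] sum_subtractf case_prod_unfold)
  finally show ?thesis .
qed

text \<open>The number of ways to write \<open>s\<close> as a product of \<open>m\<close> transpositions.\<close>

primrec fact_count :: "nat \<Rightarrow> nat \<Rightarrow> (nat \<Rightarrow> nat) \<Rightarrow> real" where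
  "fact_count n 0 s = of_bool (s = id)"
| "fact_count n (Suc m) s = (\<Sum>(i, j)\<in>edges n. fact_count n m (Transposition.transpose i j \<circ> s))"

lemma fact_count_nonneg: "fact_count n m s \<ge> 0"
  by (induction m arbitrary: s) (auto intro!: sum_nonneg)

lemma fact_count_outside: "s \<notin> sym_grp n \<Longrightarrow> fact_count n m s = 0"
proof (induction m arbitrary: s)
  case 0
  then show ?case using id_in_sym_grp by auto
next
  case (Suc m)
  then show ?case by (auto intro!: sum.neutral simp: transpose_comp_in_sym_grp)
qed

lemma fact_count_sum: "(\<Sum>s\<in>sym_grp n. fact_count n m s) = real (card (edges n)) ^ m"
proof (induction m)
  case 0
  then show ?case using id_in_sym_grp finite_sym_grp by (simp add: of_bool_def)
next
  case (Suc m)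
  have "(\<Sum>s\<in>sym_grp n. fact_count n (Suc m) s) =
      (\<Sum>e\<in>edges n. \<Sum>s\<in>sym_grp n. fact_count n m (Transposition.transpose (fst e) (snd e) \<circ> s))"
    by (simp add: case_prod_unfold sum.swap[of _ "sym_grp n"])
  also have "\<dots> = (\<Sum>e\<in>edges n. \<Sum>s\<in>sym_grp n. fact_count n m s)"
  proof (rule sum.cong[OF refl])
    fix e assume "e \<in> edges n"
    then have e: "(fst e, snd e) \<in> edges n" by simp
    show "(\<Sum>s\<in>sym_grp n. fact_count n m (Transposition.transpose (fst e) (snd e) \<circ> s)) =
        (\<Sum>s\<in>sym_grp n. fact_count n m s)"
      by (rule sum.reindex_bij_witness[where i = "\<lambda>s. Transposition.transpose (fst e) (snd e) \<circ> s"
            and j = "\<lambda>s. Transposition.transpose (fst e) (snd e) \<circ> s"])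
        (simp_all add: transpose_comp_in_sym_grp[OF e] comp_assoc[symmetric])
  qed
  finally show ?case using Suc by simp
qed

lemma fact_count_le: "fact_count n m s \<le> real (card (edges n)) ^ m"
proof (cases "s \<in> sym_grp n")
  case True
  then show ?thesis
    using member_le_sum[of s "sym_grp n" "fact_count n m"] finite_sym_grp
    by (simp add: fact_count_nonneg fact_count_sum)
qed (simp add: fact_count_outside)

lemma ga_power_interchange_gen:
  "ga_power n (\<lambda>u. complex_of_real t * interchange_gen n u) m s / fact m =
     complex_of_real (\<Sum>j\<le>m. (t ^ j * fact_count n j s / fact j) *
       ((- t * real (card (edges n))) ^ (m - j) / fact (m - j)))"
proof -
  define N where "N = real (card (edges n))"
  define S where "S m s = (\<Sum>j\<le>m. real (m choose j) * ((- N) ^ (m - j) * fact_count n j s))" for m s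
  have step: "S (Suc m) s = (\<Sum>(i, j)\<in>edges n. S m (Transposition.transpose i j \<circ> s)) - N * S m s" for m s
  proof -
    have "S (Suc m) s = (- N) ^ Suc m * fact_count n 0 s +
        (\<Sum>j\<le>m. real (Suc m choose Suc j) * ((- N) ^ (m - j) * fact_count n (Suc j) s))"
      unfolding S_def by (subst sum.atMost_Suc_shift) simp
    also have "(\<Sum>j\<le>m. real (Suc m choose Suc j) * ((- N) ^ (m - j) * fact_count n (Suc j) s)) =
        (\<Sum>j\<le>m. real (m choose j) * ((- N) ^ (m - j) * fact_count n (Suc j) s)) +
        (\<Sum>j\<le>m. real (m choose Suc j) * ((- N) ^ (m - j) * fact_count n (Suc j) s))"
      by (simp add: sum.distrib algebra_simps del: fact_count.simps)
    also have "(\<Sum>j\<le>m. real (m choose j) * ((- N) ^ (m - j) * fact_count n (Suc j) s)) =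
        (\<Sum>(i, j)\<in>edges n. S m (Transposition.transpose i j \<circ> s))"
      unfolding S_def case_prod_unfold
      by (subst sum.swap) (simp add: sum_distrib_left case_prod_unfold)
    also have "(\<Sum>j\<le>m. real (m choose Suc j) * ((- N) ^ (m - j) * fact_count n (Suc j) s)) =
        - N * S m s - (- N) ^ Suc m * fact_count n 0 s"
    proof -
      have "- N * S m s = (\<Sum>j\<le>Suc m. real (m choose j) * ((- N) ^ (Suc m - j) * fact_count n j s))"
        unfolding S_def sum_distrib_left
        by (simp add: Suc_diff_le binomial_eq_0 del: fact_count.simps cong: sum.cong)
          (auto intro!: sum.cong simp: sum_negf[symmetric] Suc_diff_le simp del: fact_count.simps)
      also have "\<dots> = (- N) ^ Suc m * fact_count n 0 s +
          (\<Sum>j\<le>m. real (m choose Suc j) * ((- N) ^ (m - j) * fact_count n (Suc j) s))"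
        by (subst sum.atMost_Suc_shift) simp
      finally show ?thesis by simp
    qed
    finally show ?thesis by (simp add: comp_def)
  qed
  have "ga_power n (\<lambda>u. complex_of_real t * interchange_gen n u) m s =
      complex_of_real (t ^ m * S m s)" for s
  proof (induction m arbitrary: s)
    case 0
    then show ?case by (simp add: S_def ga_of_def)
  next
    case (Suc m)
    show ?case
      by (simp only: ga_power.simps ga_mult_interchange_gen Suc step N_def)
        (simp add: case_prod_unfold sum_distrib_left algebra_simps comp_def)
  qed
  moreover have "t ^ m * S m s / fact m = (\<Sum>j\<le>m. (t ^ j * fact_count n j s / fact j) *
       ((- t * N) ^ (m - j) / fact (m - j)))"
    unfolding S_def sum_distrib_left sum_divide_distrib
  proof (rule sum.cong[OF refl])
    fix j assume "j \<in> {..m}"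
    then have j: "j \<le> m" by simp
    have "t ^ m = t ^ j * t ^ (m - j)" using j by (simp add: power_add[symmetric])
    then show "t ^ m * (real (m choose j) * ((- N) ^ (m - j) * fact_count n j s)) / fact m =
        (t ^ j * fact_count n j s / fact j) * ((- t * N) ^ (m - j) / fact (m - j))"
      using binomial_fact[OF j, where ?'a = real] power_mult_distrib[of t "- N" "m - j"]
      by (simp add: field_simps)
  qed
  ultimately show ?thesis
    by (metis N_def of_real_divide of_real_fact)
qed

lemma fact_count_summable:
  "summable (\<lambda>j. norm (t ^ j * fact_count n j s / fact j))"
proof (rule summable_comparison_test')
  show "summable (\<lambda>j. norm (inverse (fact j) *\<^sub>R (\<bar>t\<bar> * real (card (edges n))) ^ j))"
    by (rule summable_norm_exp)
  show "norm (norm (t ^ j * fact_count n j s / fact j))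
      \<le> norm (inverse (fact j) *\<^sub>R (\<bar>t\<bar> * real (card (edges n))) ^ j)" for j
    using mult_left_mono[OF fact_count_le[of n j s], of "\<bar>t\<bar> ^ j"]
    by (simp add: abs_mult power_abs power_mult_distrib fact_count_nonneg field_simps)
qed

lemma ga_exp_sums:
  "(\<lambda>m. ga_power n (\<lambda>u. complex_of_real t * interchange_gen n u) m s / fact m) sums
     complex_of_real ((\<Sum>j. t ^ j * fact_count n j s / fact j) * exp (- t * real (card (edges n))))"
proof -
  let ?x = "- t * real (card (edges n))"
  have "summable (\<lambda>l. norm (?x ^ l / fact l))"
    using summable_norm_exp[of ?x] by (simp add: divide_inverse mult.commute)
  from Cauchy_product_sums[OF fact_count_summable[of t n s] this]
  show ?thesis
    unfolding ga_power_interchange_gen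
    by (subst sums_of_real_iff) (simp add: exp_def divide_inverse mult_ac)
qed

lemma ga_exp_interchange_gen:
  "ga_exp n (\<lambda>u. complex_of_real t * interchange_gen n u) s =
     complex_of_real ((\<Sum>j. t ^ j * fact_count n j s / fact j) * exp (- t * real (card (edges n))))"
  unfolding ga_exp_def using ga_exp_sums by (rule sums_unique[symmetric])

theorem pmf_interchange_law:
  assumes "t \<ge> 0"
  shows "complex_of_real (pmf (interchange_law n t) s) =
           ga_exp n (\<lambda>u. complex_of_real t * interchange_gen n u) s"
proof -
  define f where "f s = (\<Sum>j. t ^ j * fact_count n j s / fact j) * exp (- t * real (card (edges n)))"
    for s
  have Re: "Re (ga_exp n (\<lambda>u. complex_of_real t * interchange_gen n u) s) = f s" for s
    by (simp only: ga_exp_interchange_gen f_def Re_complex_of_real)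
  have nonneg: "f s \<ge> 0" for s
    using assms summable_norm_cancel[OF fact_count_summable, of t n s]
    by (auto simp: f_def fact_count_nonneg intro!: mult_nonneg_nonneg suminf_nonneg)
  have outside: "f s = 0" if "s \<notin> sym_grp n" for s
    using that by (simp add: f_def fact_count_outside)
  have "(\<lambda>j. \<Sum>s\<in>sym_grp n. t ^ j * fact_count n j s / fact j) sums
      (\<Sum>s\<in>sym_grp n. \<Sum>j. t ^ j * fact_count n j s / fact j)"
    by (intro sums_sum summable_sums summable_norm_cancel[OF fact_count_summable])
  moreover have "(\<Sum>s\<in>sym_grp n. t ^ j * fact_count n j s / fact j) =
      (t * real (card (edges n))) ^ j /\<^sub>R fact j" for j
    by (simp only: sum_divide_distrib[symmetric] sum_distrib_left[symmetric] fact_count_sum)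
      (simp add: power_mult_distrib divide_inverse)
  ultimately have "(\<Sum>s\<in>sym_grp n. \<Sum>j. t ^ j * fact_count n j s / fact j) =
      exp (t * real (card (edges n)))"
    unfolding exp_def by (simp add: sums_iff)
  then have total: "(\<Sum>s\<in>sym_grp n. f s) = 1"
    by (simp add: f_def sum_distrib_right[symmetric] mult_exp_exp)
  have "(\<integral>\<^sup>+s. ennreal (f s) \<partial>count_space UNIV) = (\<Sum>s\<in>sym_grp n. ennreal (f s))"
    using finite_sym_grp outside by (intro nn_integral_count_space'[of "sym_grp n"]) auto
  also have "\<dots> = 1"
    using total nonneg by (simp add: sum_ennreal)
  finally have "pmf (interchange_law n t) s = f s"
    unfolding interchange_law_def Re using nonneg by (intro pmf_embed_pmf) auto
  then show ?thesis
    by (simp add: ga_exp_interchange_gen f_def)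
qed

end

(*
  Call F(s; x, z) the product of x^l + 1 - z^l over the cycles of s, l being the length. A
  transposition merges two cycles or cuts one, so the sum of F over the neighbours of s is a
  differential operator in (x, z) applied to F. Conjugating it by (x - 1) / ((1 - z) (x - z)) turns
  it into the operator (n choose 2) - (n - A) (A + B + 1), A = x d/dx, B = z d/dz, which is diagonal
  on monomials; hence the coefficients of the polynomial part P of (x - 1) F / ((1 - z) (x - z)) are
  eigenfunctions of the generator. (They are, up to sign, the irreducible characters of the double
  hook shapes (m, k - i, 1^i).) With m = n - k, the coefficient of x^m in P at z = 1 is k s_k - 1 and
  its z^i part decays at rate k (m + 1 + i), so evaluating P at the identity gives, for q = exp (-k t),
    k E(s_k(t)) = (n choose m) q^(m + 1) (1 - q)^(k - 1) + Prob (Bin (n, q) <= m).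
  Both terms are controlled by the Chernoff bound with tilt exp (k (t - t_{n,k})).
*)
theory Submission
  imports Defs
begin

subsection \<open>Multiplication by a transposition and cycles\<close>

text \<open>Put H = (x - 1) / ((1 - z) (x - z)). The obstacle is that H F is not a polynomial, so it
  has no coefficients to compare: F equals x^n at z = 1 and 1 at x = z, which leaves poles there.
  They are cancelled by K = 1 / (x - z) - x^n / (1 - z), and P = H F + K. The correction does not
  disturb the eigenvalue equation. K does not involve the permutation, so summing over neighbours
  multiplies it by the number of edges; and the product (n - A) (A + B + 1) kills it, because 1 / (x
  - z) is homogeneous of degree -1 while n - A annihilates x^n times any function of z. No partial
  derivative in z is ever taken: A + B is obtained by scaling both variables at once, A by
  differentiating in x.\<close>

lemma orbit_eq_iff:
  assumes "permutation f"
  shows "orbit f x = orbit f y \<longleftrightarrow> x \<in> orbit f y"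
proof
  show "orbit f x = orbit f y \<Longrightarrow> x \<in> orbit f y"
    using permutation_self_in_orbit[OF assms, of x] by simp
next
  assume x: "x \<in> orbit f y"
  have y: "y \<in> orbit f x"
    using orbit_swap[OF permutation_self_in_orbit[OF assms] x] .
  show "orbit f x = orbit f y" using orbit_trans[OF _ x] orbit_trans[OF _ y] by auto
qed

text \<open>The product moves along the cycle of \<open>i\<close> as \<open>f\<close> does, except
  that the point that would return to \<open>i\<close> is sent to \<open>j\<close>, and
  symmetrically for \<open>j\<close>; so the two cycles are spliced into one.\<close>

lemma orbit_transpose_merge:
  assumes f: "permutation f" and j: "j \<notin> orbit f i"
  shows "orbit (Transposition.transpose i j \<circ> f) i = orbit f i \<union> orbit f j"
    and "orbit (Transposition.transpose i j \<circ> f) j = orbit f i \<union> orbit f j"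
proof -
  define g where "g = Transposition.transpose i j \<circ> f"
  have g: "permutation g"
    unfolding g_def using f by (intro permutation_compose permutation_swap_id)
  have self: "x \<in> orbit f x" "x \<in> orbit g x" for x
    using f g by (simp_all add: permutation_self_in_orbit)
  have i: "i \<notin> orbit f j" using j orbit_swap[OF self(1)] by blast
  \<comment> \<open>Along the \<open>f\<close>-cycle of \<open>a\<close>, the map \<open>g\<close>
    differs from \<open>f\<close> only in the step back to \<open>a\<close>, and \<open>a\<close>
    lies in its own \<open>g\<close>-orbit anyway.\<close>
  have into: "y \<in> orbit g a" if "y \<in> orbit f a" "a \<in> {i, j}" for a y
    using that(1)
  proof induction
    case base
    then show ?case
    proof (cases "f a = a")
      case False
      then have "g a = f a"
        using that(2) i j orbit.base[of f i] orbit.base[of f j] unfolding g_def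
        by (auto simp: Transposition.transpose_def)
      then show ?thesis using orbit.base[of g a] by simp
    qed (use self in simp)
  next
    case (step y)
    then show ?case
    proof (cases "f y = a")
      case False
      have "f y \<in> orbit f a" using step.hyps by (rule orbit.step)
      then have "g y = f y" using False that(2) i j unfolding g_def by (auto simp: Transposition.transpose_def)
      then show ?thesis using orbit.step[OF step.IH] by simp
    qed (use self in simp)
  qed
  have cross: "b \<in> orbit g a" if "(a, b) = (i, j) \<or> (a, b) = (j, i)" for a b
  proof -
    have "a \<in> orbit (inv f) a" using f by (simp add: orbit_inv_eq self)
    \<comment> \<open>The predecessor of \<open>a\<close> is the last point of the old cycle; this
      is where \<open>g\<close> crosses over to \<open>b\<close>.\<close>
    have "inv f a \<in> orbit f a" using orbit.base[of "inv f" a] f by (simp add: orbit_inv_eq)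
    then have "inv f a \<in> orbit g a" using into that by blast
    then have "g (inv f a) \<in> orbit g a" by (rule orbit.step)
    moreover have "f (inv f a) = a" using permutation_bijective[OF f] by (simp add: bij_is_surj surj_f_inv_f)
    ultimately show ?thesis using that unfolding g_def by auto
  qed
  have eq: "orbit g i = orbit g j"
    using cross[of j i] orbit_eq_iff[OF g] by blast
  have sub: "y \<in> orbit f i \<union> orbit f j" if "y \<in> orbit g i" for y
    using that
  proof induction
    case base
    then show ?case
      using self(1) orbit.base[of f] unfolding g_def by (auto simp: Transposition.transpose_def)
  next
    case (step y)
    then have "f y \<in> orbit f i \<union> orbit f j" by (auto intro: orbit.step)
    then show ?case using self(1) unfolding g_def by (auto simp: Transposition.transpose_def)
  qed
  have "orbit g i = orbit f i \<union> orbit f j"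
    using sub into[of _ i] into[of _ j] eq by blast
  then show "orbit (Transposition.transpose i j \<circ> f) i = orbit f i \<union> orbit f j"
    and "orbit (Transposition.transpose i j \<circ> f) j = orbit f i \<union> orbit f j"
    using eq unfolding g_def by simp_all
qed

lemma orbit_transpose_other:
  assumes f: "permutation f" and x: "i \<notin> orbit f x" "j \<notin> orbit f x"
  shows "orbit (Transposition.transpose i j \<circ> f) x = orbit f x"
proof (rule orbit_cong)
  show "x \<in> orbit f x" using f by (rule permutation_self_in_orbit)
  fix s assume "s \<in> orbit f x"
  then have "f s \<in> orbit f x" by (rule orbit.step)
  then show "(Transposition.transpose i j \<circ> f) s = f s"
    using x by (auto simp: Transposition.transpose_def)
qed

text \<open>The new map follows \<open>f\<close> for \<open>d - 1\<close> steps; step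
  \<open>d\<close> would reach \<open>(f ^^ d) i\<close> and is redirected to \<open>i\<close>,
  which closes a cycle of length \<open>d\<close>. The second claim is what allows \<open>f\<close>
  to be seen as a merge of two cycles of \<open>g\<close>.\<close>

lemma orbit_transpose_split:
  assumes f: "permutation f" and d: "0 < d" "d < card (orbit f i)"
  defines "g \<equiv> Transposition.transpose i ((f ^^ d) i) \<circ> f"
  shows "card (orbit g i) = d" and "(f ^^ d) i \<notin> orbit g i"
proof -
  have self: "i \<in> orbit f i" using f by (rule permutation_self_in_orbit)
  define l where "l = funpow_dist1 f i i"
  have img: "orbit f i = (\<lambda>m. (f ^^ m) i) ` {0..<l}"
    unfolding l_def using self by (rule orbit_conv_funpow_dist1)
  have inj: "inj_on (\<lambda>m. (f ^^ m) i) {0..<l}"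
    unfolding l_def using self by (rule inj_on_funpow_dist1)
  have dl: "d < l" using d(2) unfolding img card_image[OF inj] by simp
  have ne: "(f ^^ a) i \<noteq> (f ^^ b) i" if "a < l" "b < l" "a \<noteq> b" for a b
    using inj that by (auto simp: inj_on_def)
  have pow: "(g ^^ a) i = (f ^^ a) i" if "a < d" for a
    using that
  proof (induction a)
    case (Suc a)
    then have "(g ^^ Suc a) i = g ((f ^^ a) i)" by simp
    then have "(g ^^ Suc a) i = Transposition.transpose i ((f ^^ d) i) ((f ^^ Suc a) i)"
      unfolding g_def by simp
    moreover have "(f ^^ Suc a) i \<noteq> (f ^^ d) i" using ne[of "Suc a" d] Suc dl by simp
    moreover have "(f ^^ Suc a) i \<noteq> i" using ne[of "Suc a" 0] Suc dl by simp
    ultimately show ?case by (simp add: Transposition.transpose_def)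
  qed simp
  have "(g ^^ d) i = i"
  proof -
    obtain a where a: "d = Suc a" using d by (cases d) auto
    then have "(g ^^ d) i = g ((f ^^ a) i)" using pow[of a] by simp
    then have "(g ^^ d) i = Transposition.transpose i ((f ^^ d) i) ((f ^^ d) i)"
      unfolding g_def a by simp
    then show ?thesis by simp
  qed
  then have "orbit g i = {(g ^^ m) i | m. m < d}" using d(1) by (rule orbit_altdef_bounded)
  also have "\<dots> = (\<lambda>m. (g ^^ m) i) ` {0..<d}" by auto
  also have "\<dots> = (\<lambda>m. (f ^^ m) i) ` {0..<d}" using pow by (intro image_cong) auto
  finally have orb: "orbit g i = (\<lambda>m. (f ^^ m) i) ` {0..<d}" .
  have "inj_on (\<lambda>m. (f ^^ m) i) {0..<d}" by (rule inj_on_subset[OF inj]) (use dl in auto)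
  then show "card (orbit g i) = d" unfolding orb by (simp add: card_image)
  show "(f ^^ d) i \<notin> orbit g i" unfolding orb
  proof
    assume "(f ^^ d) i \<in> (\<lambda>m. (f ^^ m) i) ` {0..<d}"
    then obtain m where "m < d" "(f ^^ d) i = (f ^^ m) i" by auto
    then show False using ne[of d m] dl by simp
  qed
qed

section \<open>Cycle sets and products of weights over the cycles\<close>

definition cycles_of :: "nat \<Rightarrow> (nat \<Rightarrow> nat) \<Rightarrow> nat set set" where
  "cycles_of n p = orbit p ` {1..n}"

text \<open>The index set consists of the cycles themselves and not of their lengths, so cycles of
  equal length contribute separate factors.\<close>

definition cycle_prod :: "nat \<Rightarrow> (nat \<Rightarrow> 'a :: comm_monoid_mult) \<Rightarrow> (nat \<Rightarrow> nat) \<Rightarrow> 'a" where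
  "cycle_prod n w p = (\<Prod>c\<in>cycles_of n p. w (card c))"

lemma permutation_sym_grp: "p \<in> sym_grp n \<Longrightarrow> permutation p"
  by (auto simp: sym_grp_def permutation_permutes)

lemma finite_cycles_of: "finite (cycles_of n p)"
  by (simp add: cycles_of_def)

lemma cycles_of_subset:
  assumes "p \<in> sym_grp n" "c \<in> cycles_of n p"
  shows "c \<subseteq> {1..n}"
  using assms permutes_orbit_subset[of p "{1..n}"] unfolding cycles_of_def sym_grp_def by blast

lemma finite_cycle: "p \<in> sym_grp n \<Longrightarrow> c \<in> cycles_of n p \<Longrightarrow> finite c"
  by (rule finite_subset[OF cycles_of_subset]) simp_all

lemma card_cycle_pos: "p \<in> sym_grp n \<Longrightarrow> c \<in> cycles_of n p \<Longrightarrow> 0 < card c"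
  using finite_cycle[of p n c] by (auto simp: cycles_of_def card_gt_0_iff orbit_nonempty)

lemma orbit_eq_cycle:
  assumes "p \<in> sym_grp n" "c \<in> cycles_of n p" "i \<in> c"
  shows "orbit p i = c"
  using assms orbit_eq_iff[OF permutation_sym_grp[OF assms(1)]] by (auto simp: cycles_of_def)

lemma sum_over_cycles:
  assumes "p \<in> sym_grp n"
  shows "(\<Sum>i\<in>{1..n}. g i) = (\<Sum>c\<in>cycles_of n p. \<Sum>i\<in>c. g i)"
proof -
  have "{x \<in> {1..n}. orbit p x = c} = c" if c: "c \<in> cycles_of n p" for c
    using orbit_eq_cycle[OF assms c] cycles_of_subset[OF assms c]
      permutation_self_in_orbit[OF permutation_sym_grp[OF assms]] by blast
  then have "(\<Sum>c\<in>cycles_of n p. sum g {x \<in> {1..n}. orbit p x = c}) = (\<Sum>c\<in>cycles_of n p. sum g c)"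
    by (intro sum.cong) auto
  then show ?thesis
    using sum.image_gen[of "{1..n}" g "orbit p"] by (simp add: cycles_of_def)
qed

lemma sum_card_cycles: "p \<in> sym_grp n \<Longrightarrow> (\<Sum>c\<in>cycles_of n p. card c) = n"
  using sum_over_cycles[of p n "\<lambda>_. 1 :: nat"] by simp

text \<open>A merge replaces two cycles by their union and leaves the rest \<open>R\<close> alone.
  The non-membership claims make the insertions disjoint, so that products over the cycles can be
  factored.\<close>

lemma cycles_of_transpose:
  assumes p: "p \<in> sym_grp n" and ij: "i \<in> {1..n}" "j \<in> {1..n}" and j: "j \<notin> orbit p i"
  defines "R \<equiv> cycles_of n p - {orbit p i, orbit p j}"
  shows "cycles_of n (Transposition.transpose i j \<circ> p) = insert (orbit p i \<union> orbit p j) R"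
    and "cycles_of n p = insert (orbit p i) (insert (orbit p j) R)"
    and "orbit p i \<notin> insert (orbit p j) R" "orbit p j \<notin> R" "orbit p i \<union> orbit p j \<notin> R"
    and "card (orbit p i \<union> orbit p j) = card (orbit p i) + card (orbit p j)"
proof -
  let ?g = "Transposition.transpose i j \<circ> p"
  have perm: "permutation p" using p by (rule permutation_sym_grp)
  note self = permutation_self_in_orbit[OF perm]
  show *: "cycles_of n p = insert (orbit p i) (insert (orbit p j) R)"
    using ij unfolding R_def cycles_of_def by auto
  have ne: "orbit p i \<noteq> orbit p j" using j self by blast
  show "orbit p i \<notin> insert (orbit p j) R" "orbit p j \<notin> R" using ne by (auto simp: R_def)
  have R: "c = orbit p i" if "c \<in> cycles_of n p" "i \<in> c" for c
    using orbit_eq_cycle[OF p that] by simp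
  show "orbit p i \<union> orbit p j \<notin> R"
    using R[of "orbit p i \<union> orbit p j"] self[of i] by (auto simp: R_def)
  have "orbit p i \<inter> orbit p j = {}"
    using orbit_eq_iff[OF perm] ne by blast
  moreover have "finite (orbit p i)" "finite (orbit p j)" using self by (auto intro: finite_orbit)
  ultimately show "card (orbit p i \<union> orbit p j) = card (orbit p i) + card (orbit p j)"
    by (simp add: card_Un_disjoint)
  have 1: "orbit ?g x = orbit p i \<union> orbit p j" if "x \<in> orbit p i \<union> orbit p j" for x
  proof -
    have "permutation ?g" using perm by (intro permutation_compose permutation_swap_id)
    then show ?thesis using that orbit_eq_iff[of ?g x i] orbit_transpose_merge[OF perm j] by simp
  qed
  have 2: "orbit ?g x = orbit p x" if "x \<notin> orbit p i \<union> orbit p j" for x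
    using that orbit_transpose_other[OF perm, of i x j] orbit_swap[OF self] by blast
  have 3: "x \<notin> orbit p i \<union> orbit p j \<longleftrightarrow> orbit p x \<in> R" if "x \<in> {1..n}" for x
    using that orbit_eq_iff[OF perm] by (auto simp: R_def cycles_of_def)
  show "cycles_of n ?g = insert (orbit p i \<union> orbit p j) R"
  proof (intro set_eqI iffI)
    fix c assume "c \<in> cycles_of n ?g"
    then obtain x where "x \<in> {1..n}" "c = orbit ?g x" by (auto simp: cycles_of_def)
    then show "c \<in> insert (orbit p i \<union> orbit p j) R" using 1 2 3 by (cases "x \<in> orbit p i \<union> orbit p j") auto
  next
    fix c assume "c \<in> insert (orbit p i \<union> orbit p j) R"
    then show "c \<in> cycles_of n ?g"
    proof
      assume "c = orbit p i \<union> orbit p j"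
      then show ?thesis using orbit_transpose_merge[OF perm j] ij by (auto simp: cycles_of_def)
    next
      assume c: "c \<in> R"
      then obtain x where x: "x \<in> {1..n}" "c = orbit p x" unfolding R_def cycles_of_def by blast
      then have "orbit ?g x = c" using 2[of x] 3[of x] c by simp
      then show ?thesis using x unfolding cycles_of_def by blast
    qed
  qed
qed

lemma cycle_prod_merge:
  fixes w :: "nat \<Rightarrow> 'a :: field"
  assumes p: "p \<in> sym_grp n" and ij: "i \<in> {1..n}" "j \<in> {1..n}" and j: "j \<notin> orbit p i"
    and w: "\<And>l. 0 < l \<Longrightarrow> w l \<noteq> 0"
  shows "cycle_prod n w (Transposition.transpose i j \<circ> p) =
    cycle_prod n w p * (w (card (orbit p i) + card (orbit p j)) / (w (card (orbit p i)) * w (card (orbit p j))))"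
proof -
  note * = cycles_of_transpose[OF p ij j]
  have fin: "finite (cycles_of n p - {orbit p i, orbit p j})" by (simp add: finite_cycles_of)
  have nz: "w (card (orbit p x)) \<noteq> 0" if "x \<in> {1..n}" for x
    using that card_cycle_pos[OF p, of "orbit p x"] w by (auto simp: cycles_of_def)
  have "cycle_prod n w p = w (card (orbit p i)) * (w (card (orbit p j)) *
      (\<Prod>c\<in>cycles_of n p - {orbit p i, orbit p j}. w (card c)))"
    unfolding cycle_prod_def using *(3,4) fin
    by (subst *(2)) (simp del: insert_Diff_single insert_Diff1 insert_Diff)
  moreover have "cycle_prod n w (Transposition.transpose i j \<circ> p) =
      w (card (orbit p i) + card (orbit p j)) * (\<Prod>c\<in>cycles_of n p - {orbit p i, orbit p j}. w (card c))"
    unfolding cycle_prod_def *(1) using *(5,6) fin by simp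
  ultimately show ?thesis using nz ij by simp
qed

text \<open>A cut is a merge read backwards: the transposition is an involution, so \<open>p\<close>
  arises from the cut permutation \<open>g\<close> by merging cycles of lengths \<open>d\<close> and
  \<open>card (orbit p i) - d\<close>. The merge formula for \<open>g\<close> is then solved for its
  own product.\<close>

lemma cycle_prod_split:
  fixes w :: "nat \<Rightarrow> 'a :: field"
  assumes p: "p \<in> sym_grp n" and i: "i \<in> {1..n}" and d: "0 < d" "d < card (orbit p i)"
    and w: "\<And>l. 0 < l \<Longrightarrow> w l \<noteq> 0"
  shows "cycle_prod n w (Transposition.transpose i ((p ^^ d) i) \<circ> p) =
    cycle_prod n w p * (w d * w (card (orbit p i) - d) / w (card (orbit p i)))"
proof -
  define j where "j = (p ^^ d) i"
  define g where "g = Transposition.transpose i j \<circ> p"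
  have perm: "permutation p" using p by (rule permutation_sym_grp)
  have "j \<in> orbit p i"
    unfolding j_def using permutation_self_in_orbit[OF perm] by (rule funpow_in_orbit)
  then have j: "j \<in> {1..n}" using cycles_of_subset[OF p, of "orbit p i"] i by (auto simp: cycles_of_def)
  have gi: "card (orbit g i) = d" "j \<notin> orbit g i"
    unfolding g_def j_def using orbit_transpose_split[OF perm d] by simp_all
  have g: "g \<in> sym_grp n"
    unfolding g_def sym_grp_def mem_Collect_eq
    using p i j by (intro permutes_compose permutes_swap_id) (auto simp: sym_grp_def)
  have pg: "p = Transposition.transpose i j \<circ> g" by (simp add: g_def comp_assoc[symmetric])
  have "orbit p i = orbit g i \<union> orbit g j"
    using orbit_transpose_merge(1)[OF permutation_sym_grp[OF g] gi(2)] pg by simp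
  then have c: "card (orbit p i) = d + card (orbit g j)"
    using cycles_of_transpose(6)[OF g i j gi(2)] gi(1) by simp
  have "cycle_prod n w p = cycle_prod n w g * (w (card (orbit p i)) / (w d * w (card (orbit g j))))"
    using cycle_prod_merge[OF g i j gi(2) w] pg c gi(1) by simp
  moreover have "w d \<noteq> 0" "w (card (orbit g j)) \<noteq> 0" "w (card (orbit p i)) \<noteq> 0"
    using w d c by auto
  ultimately show ?thesis using c unfolding g_def j_def by simp
qed

text \<open>Doubling makes the sum run over ordered pairs of distinct points. For fixed
  \<open>i\<close>, a partner at distance \<open>d\<close> along its own cycle gives a cut, a
  partner in another cycle a merge. The resulting ratio depends only on cycle lengths, whence the
  factors \<open>card c\<close> and \<open>card c'\<close>.\<close>

theorem sum_cycle_prod_edges: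
  fixes w :: "nat \<Rightarrow> real"
  assumes p: "p \<in> sym_grp n" and w: "\<And>l. 0 < l \<Longrightarrow> w l \<noteq> 0"
  shows "2 * (\<Sum>(i, j)\<in>edges n. cycle_prod n w (Transposition.transpose i j \<circ> p)) =
    cycle_prod n w p *
     ((\<Sum>c\<in>cycles_of n p. card c * (\<Sum>d\<in>{1..<card c}. w d * w (card c - d)) / w (card c)) +
      (\<Sum>c\<in>cycles_of n p. \<Sum>c'\<in>cycles_of n p - {c}.
         card c * card c' * w (card c + card c') / (w (card c) * w (card c'))))"
proof -
  let ?T = "\<lambda>i j. cycle_prod n w (Transposition.transpose i j \<circ> p)"
  let ?F = "cycle_prod n w p"
  have perm: "permutation p" using p by (rule permutation_sym_grp)
  have off: "{(i, j). i \<in> {1..n} \<and> j \<in> {1..n} - {i}} = edges n \<union> prod.swap ` edges n"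
    by (auto simp: edges_def image_iff)
  have "(\<Sum>i\<in>{1..n}. \<Sum>j\<in>{1..n} - {i}. ?T i j) = (\<Sum>(i, j)\<in>edges n \<union> prod.swap ` edges n. ?T i j)"
    unfolding off[symmetric] by (subst sum.Sigma) (auto simp: Sigma_def intro!: sum.cong)
  also have "\<dots> = (\<Sum>(i, j)\<in>edges n. ?T i j) + (\<Sum>(i, j)\<in>prod.swap ` edges n. ?T i j)"
    by (intro sum.union_disjoint) (auto simp: finite_edges, auto simp: edges_def)
  also have "(\<Sum>(i, j)\<in>prod.swap ` edges n. ?T i j) = (\<Sum>(i, j)\<in>edges n. ?T i j)"
    by (subst sum.reindex) (auto simp: case_prod_unfold transpose_commute intro!: sum.cong)
  finally have "2 * (\<Sum>(i, j)\<in>edges n. ?T i j) = (\<Sum>i\<in>{1..n}. \<Sum>j\<in>{1..n} - {i}. ?T i j)"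
    by (simp only: mult_2)
  also have "\<dots> = (\<Sum>c\<in>cycles_of n p. \<Sum>i\<in>c. \<Sum>j\<in>{1..n} - {i}. ?T i j)"
    by (rule sum_over_cycles[OF p])
  also have "\<dots> = (\<Sum>c\<in>cycles_of n p. \<Sum>i\<in>c.
      ?F * ((\<Sum>d\<in>{1..<card c}. w d * w (card c - d)) / w (card c)) +
      ?F * (\<Sum>c'\<in>cycles_of n p - {c}. card c' * w (card c + card c') / (w (card c) * w (card c'))))"
  proof (intro sum.cong refl)
    fix c i assume c: "c \<in> cycles_of n p" and i: "i \<in> c"
    have ci: "orbit p i = c" using orbit_eq_cycle[OF p c i] .
    have i': "i \<in> {1..n}" using cycles_of_subset[OF p c] i by auto
    have fin: "finite c" using finite_cycle[OF p c] .
    have notin: "j \<notin> c" if "c' \<in> cycles_of n p - {c}" "j \<in> c'" for c' j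
      using orbit_eq_cycle[OF p, of c' j] orbit_eq_cycle[OF p c, of j] that by auto
    \<comment> \<open>Padding with 0 at \<open>j = i\<close> gives a sum over all points, which can
      be grouped by cycles.\<close>
    have "(\<Sum>j\<in>{1..n} - {i}. ?T i j) = (\<Sum>j\<in>{1..n}. if j = i then 0 else ?T i j)"
      using i' by (simp add: sum.remove[of _ i])
    also have "\<dots> = (\<Sum>j\<in>c. if j = i then 0 else ?T i j) +
        (\<Sum>c'\<in>cycles_of n p - {c}. \<Sum>j\<in>c'. if j = i then 0 else ?T i j)"
      unfolding sum_over_cycles[OF p] using c by (intro sum.remove finite_cycles_of)
    also have "(\<Sum>c'\<in>cycles_of n p - {c}. \<Sum>j\<in>c'. if j = i then 0 else ?T i j) =
        (\<Sum>c'\<in>cycles_of n p - {c}. \<Sum>j\<in>c'. ?F * (w (card c + card c') / (w (card c) * w (card c'))))"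
    proof (intro sum.cong refl)
      fix c' j assume c': "c' \<in> cycles_of n p - {c}" and j: "j \<in> c'"
      have "j \<noteq> i" using notin[OF c' j] i by auto
      moreover have "orbit p j = c'" using orbit_eq_cycle[OF p _ j] c' by simp
      moreover have "j \<in> {1..n}" using cycles_of_subset[OF p, of c'] c' j by auto
      ultimately show "(if j = i then 0 else ?T i j) =
          ?F * (w (card c + card c') / (w (card c) * w (card c')))"
        using cycle_prod_merge[OF p i' _ _ w, of j] notin[OF c' j] ci by simp
    qed
    also have "\<dots> = ?F * (\<Sum>c'\<in>cycles_of n p - {c}. card c' * w (card c + card c') / (w (card c) * w (card c')))"
      by (simp add: sum_distrib_left algebra_simps)
    also have "(\<Sum>j\<in>c. if j = i then 0 else ?T i j) = (\<Sum>d\<in>{1..<card c}. ?T i ((p ^^ d) i))"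
    proof -
      define l where "l = funpow_dist1 p i i"
      have self: "i \<in> orbit p i" using perm by (rule permutation_self_in_orbit)
      have img: "c = (\<lambda>m. (p ^^ m) i) ` {0..<l}"
        unfolding l_def ci[symmetric] using self by (rule orbit_conv_funpow_dist1)
      have inj: "inj_on (\<lambda>m. (p ^^ m) i) {0..<l}"
        unfolding l_def using self by (rule inj_on_funpow_dist1)
      have l: "card c = l" unfolding img card_image[OF inj] by simp
      have l0: "0 < l" using card_cycle_pos[OF p c] l by simp
      have "(\<Sum>j\<in>c. if j = i then 0 else ?T i j) =
          (\<Sum>d\<in>{0..<l}. if (p ^^ d) i = i then 0 else ?T i ((p ^^ d) i))"
        by (subst img) (simp add: sum.reindex[OF inj])
      \<comment> \<open>Distance 0 is the point \<open>i\<close> itself and carries the padded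
        0.\<close>
      also have "\<dots> = (\<Sum>d\<in>{1..<l}. if (p ^^ d) i = i then 0 else ?T i ((p ^^ d) i))"
        using l0 by (simp add: sum.atLeast_Suc_lessThan)
      also have "\<dots> = (\<Sum>d\<in>{1..<l}. ?T i ((p ^^ d) i))"
      proof (intro sum.cong refl)
        fix d assume "d \<in> {1..<l}"
        then have "(p ^^ d) i \<noteq> (p ^^ 0) i" using inj_onD[OF inj, of d 0] l0 by auto
        then show "(if (p ^^ d) i = i then 0 else ?T i ((p ^^ d) i)) = ?T i ((p ^^ d) i)" by simp
      qed
      finally show ?thesis unfolding l .
    qed
    also have "\<dots> = (\<Sum>d\<in>{1..<card c}. ?F * (w d * w (card c - d) / w (card c)))"
      by (intro sum.cong refl) (use cycle_prod_split[OF p i' _ _ w] ci in auto)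
    also have "\<dots> = ?F * ((\<Sum>d\<in>{1..<card c}. w d * w (card c - d)) / w (card c))"
      by (simp add: sum_distrib_left sum_divide_distrib)
    finally show "(\<Sum>j\<in>{1..n} - {i}. ?T i j) =
      ?F * ((\<Sum>d\<in>{1..<card c}. w d * w (card c - d)) / w (card c)) +
      ?F * (\<Sum>c'\<in>cycles_of n p - {c}. card c' * w (card c + card c') / (w (card c) * w (card c')))" .
  qed
  also have "\<dots> = ?F *
     ((\<Sum>c\<in>cycles_of n p. card c * (\<Sum>d\<in>{1..<card c}. w d * w (card c - d)) / w (card c)) +
      (\<Sum>c\<in>cycles_of n p. \<Sum>c'\<in>cycles_of n p - {c}.
         card c * card c' * w (card c + card c') / (w (card c) * w (card c'))))"
    by (simp add: sum.distrib sum_distrib_left distrib_left mult_ac)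
  finally show ?thesis .
qed

subsection \<open>The differential operator\<close>

lemma sum_mixed_powers:
  fixes u v :: real
  assumes "0 < l"
  shows "(u - v) * (\<Sum>d\<in>{1..<l}. u ^ d * v ^ (l - d)) = u ^ l * v - u * v ^ l"
  using assms
proof (induction l rule: nat_induct_non_zero)
  case (Suc l)
  have "(\<Sum>d\<in>{1..<Suc l}. u ^ d * v ^ (Suc l - d)) = (\<Sum>d\<in>{1..<l}. u ^ d * v ^ (l - d)) * v + u ^ l * v"
    using Suc by (auto simp: sum_distrib_right Suc_diff_le intro!: sum.cong)
  then have "(u - v) * (\<Sum>d\<in>{1..<Suc l}. u ^ d * v ^ (Suc l - d)) =
      ((u - v) * (\<Sum>d\<in>{1..<l}. u ^ d * v ^ (l - d))) * v + (u - v) * u ^ l * v"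
    by (simp add: algebra_simps)
  also have "\<dots> = u ^ Suc l * v - u * v ^ Suc l" unfolding Suc.IH by (simp add: algebra_simps)
  finally show ?case .
qed simp

text \<open>In plethystic notation this is the power sum of degree \<open>l\<close> at x + 1 - z.
  Products over cycles are therefore specialised power sum products, which generate character values
  by Frobenius' formula.\<close>

definition wt :: "real \<Rightarrow> real \<Rightarrow> nat \<Rightarrow> real" where
  "wt x z l = x ^ l + 1 - z ^ l"

text \<open>On this region all weights and the denominators x - 1, 1 - z and x - z are positive, so
  every division is legitimate; it is still large enough to determine polynomials.\<close>

lemma wt_pos: "1 < x \<Longrightarrow> 0 < z \<Longrightarrow> z < 1 \<Longrightarrow> 0 < l \<Longrightarrow> 0 < wt x z l"
  using power_le_one[of z l] zero_less_power[of x l] unfolding wt_def by linarith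

text \<open>The product of the two weights expands into nine mixed sums \<open>g u v\<close> with
  \<open>u\<close>, \<open>v\<close> among x, 1, z. The three diagonal ones are constant sums, the
  others geometric; z^l gets a plus sign because both its factors carry a minus.\<close>

lemma wt_convolution:
  assumes "0 < l" "x \<noteq> 1" "z \<noteq> 1" "x \<noteq> z"
  shows "(\<Sum>d\<in>{1..<l}. wt x z d * wt x z (l - d)) =
    (real l - 1) * (x ^ l + 1 + z ^ l) + 2 * (x ^ l - x) / (x - 1)
      - 2 * (x ^ l * z - x * z ^ l) / (x - z) - 2 * (z ^ l - z) / (z - 1)"
proof -
  define g where "g u v = (\<Sum>d\<in>{1..<l}. u ^ d * v ^ (l - d))" for u v :: real
  have g: "g u v = (u ^ l * v - u * v ^ l) / (u - v)" if "u \<noteq> v" for u v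
    using sum_mixed_powers[OF assms(1), of u v] that unfolding g_def by (simp add: field_simps)
  have diag: "g u u = (real l - 1) * u ^ l" for u
  proof -
    have "g u u = (\<Sum>d\<in>{1..<l}. u ^ l)"
      unfolding g_def by (intro sum.cong) (auto simp: power_add[symmetric])
    then show ?thesis using assms(1) by (simp add: of_nat_diff)
  qed
  have "(\<Sum>d\<in>{1..<l}. wt x z d * wt x z (l - d)) = g x x + g x 1 - g x z + (g 1 x + g 1 1 - g 1 z) - (g z x + g z 1 - g z z)"
    unfolding g_def wt_def sum.distrib[symmetric] sum_subtractf[symmetric]
    by (intro sum.cong refl) (simp add: algebra_simps)
  also have "\<dots> = (real l - 1) * (x ^ l + 1 + z ^ l) + 2 * (x ^ l - x) / (x - 1)
      - 2 * (x ^ l * z - x * z ^ l) / (x - z) - 2 * (z ^ l - z) / (z - 1)"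
  proof -
    have "g 1 x = g x 1" "g 1 z = g z 1" "g z x = g x z"
      using assms by (simp_all add: g divide_simps) (simp_all add: algebra_simps)
    moreover have "g x 1 = (x ^ l - x) / (x - 1)" "g x z = (x ^ l * z - x * z ^ l) / (x - z)" "g z 1 = (z ^ l - z) / (z - 1)"
      using assms by (simp_all add: g)
    ultimately show ?thesis by (simp add: diag algebra_simps)
  qed
  finally show ?thesis .
qed

section \<open>Edge sum and derivatives of the cycle product at a generic point\<close>

context
  fixes n :: nat and p :: "nat \<Rightarrow> nat" and x z :: real
  assumes p: "p \<in> sym_grp n" and x: "1 < x" and z: "0 < z" "z < 1"
begin

text \<open>Logarithmic derivatives of the cycle product F: with A = x d/dx and B = z d/dz,
  \<open>wt_sum_x\<close> is A log F, \<open>wt_sum_z\<close> is - B log F, and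
  \<open>wt_sum_sq\<close> is - A applied to \<open>wt_sum_1\<close>.\<close>

definition "wt_sum_1 = (\<Sum>c\<in>cycles_of n p. real (card c) / wt x z (card c))"
definition "wt_sum_x = (\<Sum>c\<in>cycles_of n p. real (card c) * x ^ card c / wt x z (card c))"
definition "wt_sum_z = (\<Sum>c\<in>cycles_of n p. real (card c) * z ^ card c / wt x z (card c))"
definition "wt_sum_sq = (\<Sum>c\<in>cycles_of n p. (real (card c))\<^sup>2 * x ^ card c / (wt x z (card c))\<^sup>2)"

text \<open>Since x^(l + l') and z^(l + l') factor, the merge terms over all pairs form a
  combination of squares; excluding equal cycles subtracts a diagonal \<open>Q\<close>, in which
  \<open>wt\<close> at length 2l appears as \<open>wt (x\<^sup>2) (z\<^sup>2)\<close> at length l.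
  The cut terms contain the same \<open>Q\<close>, so it cancels and only first-order sums and
  \<open>wt_sum_sq\<close> survive.\<close>

lemma sum_edges_wt:
  "2 * (\<Sum>(i, j)\<in>edges n. cycle_prod n (wt x z) (Transposition.transpose i j \<circ> p)) =
    cycle_prod n (wt x z) p * (wt_sum_x\<^sup>2 + wt_sum_1\<^sup>2 - wt_sum_z\<^sup>2 + 2 * wt_sum_sq - (wt_sum_x + wt_sum_1 + wt_sum_z)
      + 2 * (wt_sum_x - x * wt_sum_1) / (x - 1) - 2 * (z * wt_sum_x - x * wt_sum_z) / (x - z) - 2 * (wt_sum_z - z * wt_sum_1) / (z - 1))"
proof -
  let ?w = "\<lambda>c. wt x z (card c)"
  have w: "wt x z l > 0" if "0 < l" for l using wt_pos[OF x z that] .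
  have wc: "?w c > 0" "0 < card c" if "c \<in> cycles_of n p" for c
    using w card_cycle_pos[OF p that] by auto
  have fin: "finite (cycles_of n p)" by (rule finite_cycles_of)
  define Q where "Q = (\<Sum>c\<in>cycles_of n p. (real (card c))\<^sup>2 * wt (x\<^sup>2) (z\<^sup>2) (card c) / (?w c)\<^sup>2)"
  have sq: "(\<Sum>c\<in>cycles_of n p. \<Sum>c'\<in>cycles_of n p. real (card c * card c') * wt x z (card c + card c') / (?w c * ?w c'))
      = wt_sum_x\<^sup>2 + wt_sum_1\<^sup>2 - wt_sum_z\<^sup>2"
    unfolding wt_sum_x_def wt_sum_1_def wt_sum_z_def power2_eq_square sum_product
      sum.distrib[symmetric] sum_subtractf[symmetric]
    by (intro sum.cong refl)
      (simp add: wt_def[of x z "_ + _"] power_add add_divide_distrib diff_divide_distrib algebra_simps)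
  have "(\<Sum>c\<in>cycles_of n p. \<Sum>c'\<in>cycles_of n p - {c}. real (card c * card c') * wt x z (card c + card c') / (?w c * ?w c'))
      = (\<Sum>c\<in>cycles_of n p. (\<Sum>c'\<in>cycles_of n p. real (card c * card c') * wt x z (card c + card c') / (?w c * ?w c'))
          - (real (card c))\<^sup>2 * wt (x\<^sup>2) (z\<^sup>2) (card c) / (?w c)\<^sup>2)"
    by (intro sum.cong refl)
      (simp add: sum_diff1 fin power2_eq_square wt_def[of x z "_ + _"] wt_def[of "x * x"] power_add power_mult_distrib)
  also have "\<dots> = wt_sum_x\<^sup>2 + wt_sum_1\<^sup>2 - wt_sum_z\<^sup>2 - Q"
    unfolding sum_subtractf sq Q_def by simp
  finally have off: "(\<Sum>c\<in>cycles_of n p. \<Sum>c'\<in>cycles_of n p - {c}. real (card c * card c') * wt x z (card c + card c') / (?w c * ?w c'))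
      = wt_sum_x\<^sup>2 + wt_sum_1\<^sup>2 - wt_sum_z\<^sup>2 - Q" .
  have "(\<Sum>c\<in>cycles_of n p. card c * (\<Sum>d\<in>{1..<card c}. wt x z d * wt x z (card c - d)) / ?w c) =
      (\<Sum>c\<in>cycles_of n p. (real (card c))\<^sup>2 * wt (x\<^sup>2) (z\<^sup>2) (card c) / (?w c)\<^sup>2
        + 2 * ((real (card c))\<^sup>2 * x ^ card c / (?w c)\<^sup>2)
        - (real (card c) * x ^ card c / ?w c + real (card c) / ?w c + real (card c) * z ^ card c / ?w c)
        + 2 / (x - 1) * (real (card c) * x ^ card c / ?w c - x * (real (card c) / ?w c))
        - 2 / (x - z) * (z * (real (card c) * x ^ card c / ?w c) - x * (real (card c) * z ^ card c / ?w c))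
        - 2 / (z - 1) * (real (card c) * z ^ card c / ?w c - z * (real (card c) / ?w c)))"
  proof (intro sum.cong refl)
    fix c assume c: "c \<in> cycles_of n p"
    define l a b w where "l = real (card c)" and "a = x ^ card c" and "b = z ^ card c" and "w = ?w c"
    have w0: "w \<noteq> 0" using wc[OF c] by (simp add: w_def)
    have wab: "w = a + 1 - b" by (simp add: w_def a_def b_def wt_def)
    have w2: "wt (x\<^sup>2) (z\<^sup>2) (card c) = a\<^sup>2 + 1 - b\<^sup>2"
      by (simp add: wt_def a_def b_def power_mult[symmetric] mult.commute)
    \<comment> \<open>Difference of squares: (a + 1 + b) (a + 1 - b) is (a + 1)^2 - b^2, and its
      cross term 2 a is the source of \<open>wt_sum_sq\<close>.\<close>
    have quad: "l * l * (a + 1 + b) / w = l\<^sup>2 * (a\<^sup>2 + 1 - b\<^sup>2) / w\<^sup>2 + 2 * (l\<^sup>2 * a / w\<^sup>2)"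
    proof -
      have "(a + 1 + b) * w = a\<^sup>2 + 1 - b\<^sup>2 + 2 * a" unfolding wab by (simp add: power2_eq_square algebra_simps)
      moreover have "l * l * (a + 1 + b) / w = l\<^sup>2 * ((a + 1 + b) * w) / w\<^sup>2"
        using w0 by (simp add: power2_eq_square)
      ultimately have "l * l * (a + 1 + b) / w = l\<^sup>2 * (a\<^sup>2 + 1 - b\<^sup>2 + 2 * a) / w\<^sup>2" by simp
      then show ?thesis by (simp add: add_divide_distrib diff_divide_distrib algebra_simps)
    qed
    have conv: "(\<Sum>d\<in>{1..<card c}. wt x z d * wt x z (card c - d)) =
        l * (a + 1 + b) - (a + 1 + b) + 2 * (a - x) / (x - 1) - 2 * (a * z - x * b) / (x - z) - 2 * (b - z) / (z - 1)"
      using wt_convolution[of "card c" x z] wc[OF c] x z by (simp add: l_def a_def b_def algebra_simps)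
    have "l * (\<Sum>d\<in>{1..<card c}. wt x z d * wt x z (card c - d)) / w =
        l * l * (a + 1 + b) / w - (l * a / w + l / w + l * b / w)
        + 2 / (x - 1) * (l * a / w - x * (l / w)) - 2 / (x - z) * (z * (l * a / w) - x * (l * b / w))
        - 2 / (z - 1) * (l * b / w - z * (l / w))"
      unfolding conv by (simp add: algebra_simps add_divide_distrib diff_divide_distrib)
    then show "card c * (\<Sum>d\<in>{1..<card c}. wt x z d * wt x z (card c - d)) / ?w c =
        (real (card c))\<^sup>2 * wt (x\<^sup>2) (z\<^sup>2) (card c) / (?w c)\<^sup>2
        + 2 * ((real (card c))\<^sup>2 * x ^ card c / (?w c)\<^sup>2)
        - (real (card c) * x ^ card c / ?w c + real (card c) / ?w c + real (card c) * z ^ card c / ?w c)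
        + 2 / (x - 1) * (real (card c) * x ^ card c / ?w c - x * (real (card c) / ?w c))
        - 2 / (x - z) * (z * (real (card c) * x ^ card c / ?w c) - x * (real (card c) * z ^ card c / ?w c))
        - 2 / (z - 1) * (real (card c) * z ^ card c / ?w c - z * (real (card c) / ?w c))"
      unfolding quad w2 l_def[symmetric] a_def[symmetric] b_def[symmetric] w_def[symmetric] by simp
  qed
  also have "\<dots> = Q + 2 * wt_sum_sq - (wt_sum_x + wt_sum_1 + wt_sum_z) + 2 / (x - 1) * (wt_sum_x - x * wt_sum_1)
      - 2 / (x - z) * (z * wt_sum_x - x * wt_sum_z) - 2 / (z - 1) * (wt_sum_z - z * wt_sum_1)"
    unfolding Q_def wt_sum_sq_def wt_sum_x_def wt_sum_1_def wt_sum_z_def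
    by (simp only: sum.distrib sum_subtractf sum_distrib_left[symmetric])
  finally show ?thesis
    using sum_cycle_prod_edges[OF p, of "wt x z"] w off by (auto simp: less_imp_neq[symmetric])
qed

lemma sums_total: "wt_sum_x + wt_sum_1 - wt_sum_z = real n"
proof -
  have "wt_sum_x + wt_sum_1 - wt_sum_z = (\<Sum>c\<in>cycles_of n p. real (card c))"
    unfolding wt_sum_x_def wt_sum_1_def wt_sum_z_def sum.distrib[symmetric] sum_subtractf[symmetric]
  proof (intro sum.cong refl)
    fix c assume "c \<in> cycles_of n p"
    then have "wt x z (card c) > 0" using wt_pos[OF x z] card_cycle_pos[OF p] by auto
    then show "real (card c) * x ^ card c / wt x z (card c) + real (card c) / wt x z (card c)
        - real (card c) * z ^ card c / wt x z (card c) = real (card c)"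
      by (simp add: divide_simps) (simp add: wt_def algebra_simps)
  qed
  then show ?thesis using sum_card_cycles[OF p] by (simp flip: of_nat_sum)
qed

text \<open>Scaling realises A + B as a derivative in one variable. A factor contributes l (x^l -
  z^l) = l (\<open>wt x z l\<close> - 1), so only \<open>n\<close> and \<open>wt_sum_1\<close>
  occur.\<close>

lemma DERIV_cycle_prod_scale:
  "((\<lambda>s. cycle_prod n (wt (s * x) (s * z)) p) has_real_derivative
     cycle_prod n (wt x z) p * (real n - wt_sum_1)) (at 1)"
proof -
  have nz: "wt x z (card c) \<noteq> 0" if "c \<in> cycles_of n p" for c
    using wt_pos[OF x z] card_cycle_pos[OF p that] by (simp add: less_imp_neq[symmetric])
  have d: "((\<lambda>s. wt (s * x) (s * z) l) has_real_derivative (real l * (x ^ l - z ^ l))) (at 1)" for l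
    unfolding wt_def power_mult_distrib
    by (auto intro!: derivative_eq_intros simp: algebra_simps)
  have "((\<lambda>s. \<Prod>c\<in>cycles_of n p. wt (s * x) (s * z) (card c)) has_real_derivative
      (\<Sum>c\<in>cycles_of n p. (real (card c) * (x ^ card c - z ^ card c)) * (\<Prod>c'\<in>cycles_of n p - {c}. wt (1 * x) (1 * z) (card c')))) (at 1)"
    by (rule has_field_derivative_prod) (use d in auto)
  also have "(\<Sum>c\<in>cycles_of n p. (real (card c) * (x ^ card c - z ^ card c)) * (\<Prod>c'\<in>cycles_of n p - {c}. wt (1 * x) (1 * z) (card c'))) =
     (\<Sum>c\<in>cycles_of n p. cycle_prod n (wt x z) p * (real (card c) - real (card c) / wt x z (card c)))"
  proof (intro sum.cong refl)
    fix c assume c: "c \<in> cycles_of n p"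
    have "cycle_prod n (wt x z) p = wt x z (card c) * (\<Prod>c'\<in>cycles_of n p - {c}. wt x z (card c'))"
      unfolding cycle_prod_def using c by (intro prod.remove finite_cycles_of)
    then show "(real (card c) * (x ^ card c - z ^ card c)) * (\<Prod>c'\<in>cycles_of n p - {c}. wt (1 * x) (1 * z) (card c')) =
        cycle_prod n (wt x z) p * (real (card c) - real (card c) / wt x z (card c))"
      using nz[OF c] by (simp add: field_simps) (simp add: wt_def[of x z "card c"] algebra_simps)
  qed
  also have "\<dots> = cycle_prod n (wt x z) p * (real n - wt_sum_1)"
    using sum_card_cycles[OF p]
    by (simp add: sum_distrib_left[symmetric] sum_subtractf wt_sum_1_def flip: of_nat_sum)
  finally show ?thesis unfolding cycle_prod_def .
qed

lemma DERIV_cycle_prod_x: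
  "((\<lambda>x. cycle_prod n (wt x z) p) has_real_derivative cycle_prod n (wt x z) p * wt_sum_x / x) (at x)"
proof -
  have nz: "wt x z (card c) \<noteq> 0" if "c \<in> cycles_of n p" for c
    using wt_pos[OF x z] card_cycle_pos[OF p that] by (simp add: less_imp_neq[symmetric])
  have d: "((\<lambda>x. wt x z l) has_real_derivative real l * x ^ l / x) (at x)" for l
  proof -
    have "real l * x ^ (l - 1) = real l * x ^ l / x" using x by (cases l) auto
    then show ?thesis unfolding wt_def by (auto intro!: derivative_eq_intros)
  qed
  have "((\<lambda>x. \<Prod>c\<in>cycles_of n p. wt x z (card c)) has_real_derivative
      (\<Sum>c\<in>cycles_of n p. (real (card c) * x ^ card c / x) * (\<Prod>c'\<in>cycles_of n p - {c}. wt x z (card c')))) (at x)"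
    by (rule has_field_derivative_prod) (use d in auto)
  also have "(\<Sum>c\<in>cycles_of n p. (real (card c) * x ^ card c / x) * (\<Prod>c'\<in>cycles_of n p - {c}. wt x z (card c'))) =
     (\<Sum>c\<in>cycles_of n p. cycle_prod n (wt x z) p * (real (card c) * x ^ card c / wt x z (card c)) / x)"
  proof (intro sum.cong refl)
    fix c assume c: "c \<in> cycles_of n p"
    have "cycle_prod n (wt x z) p = wt x z (card c) * (\<Prod>c'\<in>cycles_of n p - {c}. wt x z (card c'))"
      unfolding cycle_prod_def using c by (intro prod.remove finite_cycles_of)
    then show "(real (card c) * x ^ card c / x) * (\<Prod>c'\<in>cycles_of n p - {c}. wt x z (card c')) =
        cycle_prod n (wt x z) p * (real (card c) * x ^ card c / wt x z (card c)) / x"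
      using nz[OF c] by simp
  qed
  also have "\<dots> = cycle_prod n (wt x z) p * wt_sum_x / x"
    by (simp add: sum_distrib_left wt_sum_x_def sum_divide_distrib)
  finally show ?thesis unfolding cycle_prod_def .
qed

lemma DERIV_wt_sum_1:
  "((\<lambda>x. \<Sum>c\<in>cycles_of n p. real (card c) / wt x z (card c)) has_real_derivative - wt_sum_sq / x) (at x)"
proof -
  have nz: "wt x z (card c) \<noteq> 0" if "c \<in> cycles_of n p" for c
    using wt_pos[OF x z] card_cycle_pos[OF p that] by (simp add: less_imp_neq[symmetric])
  have d: "((\<lambda>x. wt x z l) has_real_derivative real l * x ^ l / x) (at x)" for l
  proof -
    have "real l * x ^ (l - 1) = real l * x ^ l / x" using x by (cases l) auto
    then show ?thesis unfolding wt_def by (auto intro!: derivative_eq_intros)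
  qed
  have "((\<lambda>x. \<Sum>c\<in>cycles_of n p. real (card c) / wt x z (card c)) has_real_derivative
      (\<Sum>c\<in>cycles_of n p. - ((real (card c))\<^sup>2 * x ^ card c / (wt x z (card c))\<^sup>2) / x)) (at x)"
  proof (intro DERIV_sum)
    fix c assume "c \<in> cycles_of n p"
    then show "((\<lambda>x. real (card c) / wt x z (card c)) has_real_derivative
       - ((real (card c))\<^sup>2 * x ^ card c / (wt x z (card c))\<^sup>2) / x) (at x)"
      using x nz by (auto intro!: derivative_eq_intros d simp: power2_eq_square mult_ac)
  qed
  then show ?thesis by (simp add: wt_sum_sq_def sum_negf sum_divide_distrib)
qed

end

subsection \<open>Eigenfunctions\<close>

text \<open>The outer variable is x and the inner one z, so \<open>coeff (coeff P r) i\<close>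
  belongs to x^r z^i.\<close>

definition poly2 :: "real poly poly \<Rightarrow> real \<Rightarrow> real \<Rightarrow> real" where
  "poly2 P x z = poly (poly P [:x:]) z"

lemma poly2_simps [simp]:
  "poly2 (P + Q) x z = poly2 P x z + poly2 Q x z"
  "poly2 (P - Q) x z = poly2 P x z - poly2 Q x z"
  "poly2 (P * Q) x z = poly2 P x z * poly2 Q x z"
  "poly2 (P ^ k) x z = poly2 P x z ^ k"
  "poly2 (prod F A) x z = (\<Prod>a\<in>A. poly2 (F a) x z)"
  "poly2 1 x z = 1"
  "poly2 [:0, 1:] x z = x"
  "poly2 [:[:0, 1:]:] x z = z"
  by (simp_all add: poly2_def poly_prod)

lemma poly_eq_sum_bound:
  fixes p :: "'a :: comm_semiring_1 poly"
  assumes "degree p \<le> N"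
  shows "poly p x = (\<Sum>i\<le>N. coeff p i * x ^ i)"
  unfolding poly_altdef
  by (rule sum.mono_neutral_left) (use assms in \<open>auto simp: coeff_eq_0\<close>)

text \<open>Fixing z first leaves a polynomial in x alone, from which the coefficient of a single
  power of x can be read off at that z.\<close>

lemma poly2_slice: "poly2 P x z = poly (map_poly (\<lambda>c. poly c z) P) x"
  by (induction P) (auto simp: poly2_def map_poly_pCons)

lemma poly2_coeffs:
  assumes "degree P \<le> N" "\<And>r. degree (coeff P r) \<le> N"
  shows "poly2 P x z = (\<Sum>r\<le>N. \<Sum>i\<le>N. coeff (coeff P r) i * x ^ r * z ^ i)"
  unfolding poly2_def poly_eq_sum_bound[OF assms(1)]
  by (simp add: poly_sum poly_const_pow poly_eq_sum_bound[OF assms(2)] sum_distrib_right sum_distrib_left mult_ac)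

lemma poly2_degree_bound: "\<exists>N. degree P \<le> N \<and> (\<forall>r. degree (coeff P r) \<le> N)"
proof (intro exI conjI allI)
  let ?N = "degree P + (\<Sum>r\<le>degree P. degree (coeff P r))"
  show "degree P \<le> ?N" by simp
  show "degree (coeff P r) \<le> ?N" for r
  proof (cases "r \<le> degree P")
    case True
    then show ?thesis using member_le_sum[of r "{..degree P}" "\<lambda>r. degree (coeff P r)"] by auto
  qed (simp add: coeff_eq_0)
qed

lemma poly_eqI_infinite:
  fixes p q :: "real poly"
  assumes "infinite S" "\<And>x. x \<in> S \<Longrightarrow> poly p x = poly q x"
  shows "p = q"
proof (rule ccontr)
  assume "p \<noteq> q"
  then have "finite {x. poly (p - q) x = 0}" by (intro poly_roots_finite) simp
  moreover have "S \<subseteq> {x. poly (p - q) x = 0}" using assms(2) by auto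
  ultimately show False using assms(1) finite_subset by blast
qed

text \<open>One variable at a time: for fixed z the polynomial in x has infinitely many zeros, hence
  each of its coefficients vanishes for all z in an interval.\<close>

lemma double_sum_coeffs_zero:
  fixes c :: "nat \<Rightarrow> nat \<Rightarrow> real"
  assumes "\<And>x z. 1 < x \<Longrightarrow> 0 < z \<Longrightarrow> z < 1 \<Longrightarrow> (\<Sum>r\<le>N. \<Sum>i\<le>N. c r i * x ^ r * z ^ i) = 0"
    and "r \<le> N" "i \<le> N"
  shows "c r i = 0"
proof -
  have coeff: "coeff (\<Sum>i\<le>N. monom (a i) i) j = a j" if "j \<le> N" for a :: "nat \<Rightarrow> real" and j
    using that by (simp add: coeff_sum if_distrib cong: if_cong)
  have "(\<Sum>i\<le>N. c r i * z ^ i) = 0" if z: "0 < z" "z < 1" for z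
  proof -
    have "(\<Sum>r\<le>N. monom (\<Sum>i\<le>N. c r i * z ^ i) r) = 0"
      by (rule poly_eqI_infinite[of "{1<..}"])
        (use assms(1)[OF _ z] in \<open>auto simp: poly_sum poly_monom sum_distrib_right sum_distrib_left mult_ac infinite_Ioi\<close>)
    then show ?thesis using coeff[OF assms(2), of "\<lambda>r. \<Sum>i\<le>N. c r i * z ^ i"] by simp
  qed
  then have "(\<Sum>i\<le>N. monom (c r i) i) = 0"
    by (intro poly_eqI_infinite[of "{0<..<1}"]) (auto simp: poly_sum poly_monom)
  then show ?thesis using coeff[OF assms(3), of "c r"] by simp
qed

section \<open>The polynomial part of the conjugated cycle product\<close>

text \<open>The polynomial \<open>P\<close> below is the part of \<open>(x - 1) F / ((1 - z) (x - z))\<close>, where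
  \<open>F = cycle_prod n (wt x z) p\<close>, that remains after the poles at \<open>z = 1\<close> and \<open>x = z\<close> are removed.\<close>

lemma ex_cycle_poly:
  assumes p: "p \<in> sym_grp n"
  shows "\<exists>P. (\<forall>x z. x \<noteq> z \<longrightarrow> z \<noteq> 1 \<longrightarrow> poly2 P x z =
      (cycle_prod n (wt x z) p - x ^ n) / (1 - z) - (cycle_prod n (wt x z) p - 1) / (x - z)) \<and>
    (\<forall>x. x \<noteq> 1 \<longrightarrow> poly2 P x 1 = (\<Sum>c\<in>cycles_of n p. real (card c) * x ^ (n - card c)) - (x ^ n - 1) / (x - 1))"
proof -
  define X Z :: "real poly poly" where "X = [:0, 1:]" and "Z = [:[:0, 1:]:]"
  have XZ [simp]: "poly2 X x z = x" "poly2 Z x z = z" for x z by (simp_all add: X_def Z_def)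
  let ?W = "\<lambda>c. X ^ card c + 1 - Z ^ card c"
  \<comment> \<open>Modulo 1 - z each factor is a power of x. The quotient at z = 1 must be tracked
    as well: 1 - z^l is 1 - z times a geometric sum with value l there, so the product rule yields
    one summand per cycle.\<close>
  have A: "\<exists>A. (\<Prod>c\<in>S. ?W c) = X ^ (\<Sum>c\<in>S. card c) + (1 - Z) * A \<and>
      (\<forall>x. poly2 A x 1 = (\<Sum>c\<in>S. real (card c) * x ^ ((\<Sum>c\<in>S. card c) - card c)))"
    if "finite S" for S :: "nat set set"
    using that
  proof (induction S)
    case empty
    then show ?case by (intro exI[of _ 0]) (simp add: poly2_def)
  next
    case (insert c S)
    define s where "s = (\<Sum>c\<in>S. card c)"
    obtain A where A: "(\<Prod>c\<in>S. ?W c) = X ^ s + (1 - Z) * A"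
      "\<And>x. poly2 A x 1 = (\<Sum>c\<in>S. real (card c) * x ^ (s - card c))"
      using insert.IH unfolding s_def by blast
    define g where "g = (\<Sum>i<card c. Z ^ i)"
    have Zg: "1 - Z ^ card c = (1 - Z) * g" unfolding g_def by (rule one_diff_power_eq)
    have evg: "poly2 g x 1 = real (card c)" for x by (simp add: g_def poly2_def poly_sum Z_def)
    show ?case
    proof (intro exI conjI allI)
      have "(\<Prod>c\<in>insert c S. ?W c) = (X ^ card c + (1 - Z) * g) * (X ^ s + (1 - Z) * A)"
        unfolding Zg[symmetric] A(1)[symmetric] using insert.hyps by simp
      also have "\<dots> = X ^ (card c + s) + (1 - Z) * (X ^ card c * A + g * X ^ s + (1 - Z) * g * A)"
        by (simp add: algebra_simps power_add)
      finally show "(\<Prod>c\<in>insert c S. ?W c) = X ^ (\<Sum>c\<in>insert c S. card c) +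
          (1 - Z) * (X ^ card c * A + g * X ^ s + (1 - Z) * g * A)"
        using insert.hyps by (simp add: s_def)
      fix x :: real
      have "x ^ card c * x ^ (s - card c') = x ^ (card c + s - card c')" if "c' \<in> S" for c'
      proof -
        have "card c' \<le> s"
          unfolding s_def using member_le_sum[OF that, of card] insert.hyps(1) by simp
        then show ?thesis using power_add[of x "card c" "s - card c'"] by simp
      qed
      then have "x ^ card c * poly2 A x 1 = (\<Sum>c'\<in>S. real (card c') * x ^ (card c + s - card c'))"
        unfolding A(2) sum_distrib_left by (intro sum.cong) (auto simp: mult_ac)
      then show "poly2 (X ^ card c * A + g * X ^ s + (1 - Z) * g * A) x 1 =
          (\<Sum>c'\<in>insert c S. real (card c') * x ^ ((\<Sum>c\<in>insert c S. card c) - card c'))"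
        using insert.hyps by (simp add: evg s_def)
    qed
  qed
  \<comment> \<open>Modulo x - z each factor is 1.\<close>
  have B: "\<exists>B. (\<Prod>c\<in>S. ?W c) = 1 + (X - Z) * B" if "finite S" for S :: "nat set set"
    using that
  proof (induction S)
    case empty
    then show ?case by (intro exI[of _ 0]) simp
  next
    case (insert c S)
    then obtain B where B: "(\<Prod>c\<in>S. ?W c) = 1 + (X - Z) * B" by blast
    obtain g where g: "X ^ card c - Z ^ card c = (X - Z) * g"
      using power_diff_sumr2[of X "card c" Z] by blast
    have "(\<Prod>c\<in>insert c S. ?W c) = (1 + (X ^ card c - Z ^ card c)) * (1 + (X - Z) * B)"
      unfolding B[symmetric] using insert.hyps by (simp add: algebra_simps)
    then have "(\<Prod>c\<in>insert c S. ?W c) = 1 + (X - Z) * (g + B + (X - Z) * g * B)"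
      unfolding g by (simp add: algebra_simps)
    then show ?case by blast
  qed
  let ?C = "cycles_of n p"
  have n: "(\<Sum>c\<in>?C. card c) = n" using sum_card_cycles[OF p] .
  obtain A where A: "(\<Prod>c\<in>?C. ?W c) = X ^ n + (1 - Z) * A"
      "\<And>x. poly2 A x 1 = (\<Sum>c\<in>?C. real (card c) * x ^ (n - card c))"
    using A[OF finite_cycles_of, of n p] unfolding n by blast
  obtain B where B: "(\<Prod>c\<in>?C. ?W c) = 1 + (X - Z) * B"
    using B[OF finite_cycles_of] by blast
  have F: "poly2 (\<Prod>c\<in>?C. ?W c) x z = cycle_prod n (wt x z) p" for x z
    by (simp add: cycle_prod_def wt_def)
  have evA: "cycle_prod n (wt x z) p = x ^ n + (1 - z) * poly2 A x z" for x z
    unfolding F[symmetric] A(1) by simp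
  have evB: "cycle_prod n (wt x z) p = 1 + (x - z) * poly2 B x z" for x z
    unfolding F[symmetric] B by simp
  show ?thesis
  proof (intro exI[of _ "A - B"] conjI allI impI)
    fix x z :: real assume xz: "x \<noteq> z" "z \<noteq> 1"
    have "poly2 A x z = (cycle_prod n (wt x z) p - x ^ n) / (1 - z)"
      using evA[of x z] xz by (simp add: field_simps)
    moreover have "poly2 B x z = (cycle_prod n (wt x z) p - 1) / (x - z)"
      using evB[of x z] xz by (simp add: field_simps)
    ultimately show "poly2 (A - B) x z = (cycle_prod n (wt x z) p - x ^ n) / (1 - z) - (cycle_prod n (wt x z) p - 1) / (x - z)"
      by simp
  next
    fix x :: real assume x: "x \<noteq> 1"
    have "poly2 B x 1 = (x ^ n - 1) / (x - 1)"
      using evA[of x 1] evB[of x 1] x by (simp add: field_simps)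
    then show "poly2 (A - B) x 1 = (\<Sum>c\<in>?C. real (card c) * x ^ (n - card c)) - (x ^ n - 1) / (x - 1)"
      by (simp add: A(2))
  qed
qed

text \<open>Only the two evaluation rules are used, so any choice serves. The rule at z = 1 is
  recorded separately because the closed form divides by 1 - z.\<close>

definition cycle_poly :: "nat \<Rightarrow> (nat \<Rightarrow> nat) \<Rightarrow> real poly poly" where
  "cycle_poly n p = (SOME P. (\<forall>x z. x \<noteq> z \<longrightarrow> z \<noteq> 1 \<longrightarrow> poly2 P x z =
      (cycle_prod n (wt x z) p - x ^ n) / (1 - z) - (cycle_prod n (wt x z) p - 1) / (x - z)) \<and>
    (\<forall>x. x \<noteq> 1 \<longrightarrow> poly2 P x 1 = (\<Sum>c\<in>cycles_of n p. real (card c) * x ^ (n - card c)) - (x ^ n - 1) / (x - 1)))"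

lemma
  assumes "p \<in> sym_grp n"
  shows poly2_cycle_poly: "x \<noteq> z \<Longrightarrow> z \<noteq> 1 \<Longrightarrow> poly2 (cycle_poly n p) x z =
      (cycle_prod n (wt x z) p - x ^ n) / (1 - z) - (cycle_prod n (wt x z) p - 1) / (x - z)"
    and poly2_cycle_poly_one: "x \<noteq> 1 \<Longrightarrow> poly2 (cycle_poly n p) x 1 =
      (\<Sum>c\<in>cycles_of n p. real (card c) * x ^ (n - card c)) - (x ^ n - 1) / (x - 1)"
  using someI_ex[OF ex_cycle_poly[OF assms]] unfolding cycle_poly_def[symmetric] by blast+

definition cycle_coeff :: "nat \<Rightarrow> nat \<Rightarrow> nat \<Rightarrow> (nat \<Rightarrow> nat) \<Rightarrow> real" where
  "cycle_coeff n r i p = coeff (coeff (cycle_poly n p) r) i"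

section \<open>The eigenvalue equation\<close>

lemma card_edges: "2 * real (card (edges n)) = real n * (real n - 1)"
proof -
  have *: "edges n = prod.swap ` (SIGMA j:{1..n}. {1..<j})"
    by (auto simp: edges_def image_iff)
  have "card (edges n) = (\<Sum>j\<in>{1..n}. j - 1)"
    unfolding * by (subst card_image) (auto simp: inj_on_def)
  moreover have "2 * real (\<Sum>j\<in>{1..n}. j - 1) = real n * (real n - 1)"
    by (induction n) (auto simp: algebra_simps)
  ultimately show ?thesis by simp
qed

text \<open>This is the conjugation itself, divided by F and doubled: \<open>S\<close>,
  \<open>T\<close>, \<open>U\<close>, \<open>m\<close> stand for \<open>wt_sum_x\<close>,
  \<open>wt_sum_1\<close>, \<open>wt_sum_sq\<close>, \<open>n\<close>, and S + T - m for
  \<open>wt_sum_z\<close>. It holds with these as independent unknowns, so nothing about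
  permutations is left in it.\<close>

lemma edge_sum_identity:
  fixes x z S T U m :: real
  assumes "x - z > 0" "x - 1 > 0" "1 - z > 0"
  shows "(x - 1) / ((1 - z) * (x - z)) * (S\<^sup>2 + T\<^sup>2 - (S + T - m)\<^sup>2 + 2 * U - (S + T + (S + T - m))
      + 2 * (S - x * T) / (x - 1) - 2 * (z * S - x * (S + T - m)) / (x - z) - 2 * ((S + T - m) - z * T) / (z - 1))
    - m * (m - 1) * ((x - 1) / ((1 - z) * (x - z)))
    + 2 * ((m - S) * (1 / (1 - z)\<^sup>2 + (x - 1) / ((1 - z) * (x - z)) * (m - T))
           - x / (x - z)\<^sup>2 * (m - T) - (x - 1) / ((1 - z) * (x - z)) * U) = 0"
proof -
  \<comment> \<open>In these variables all denominators are products of the positive quantities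
    \<open>a\<close>, \<open>b\<close> and \<open>a + b\<close>.\<close>
  define a b where "a = x - 1" and "b = 1 - z"
  have xz: "x = a + 1" "z = 1 - b" "x - 1 = a" "1 - z = b" "x - z = a + b" "z - 1 = - b"
    by (simp_all add: a_def b_def)
  have "a > 0" "b > 0" "a + b > 0" using assms by (simp_all add: a_def b_def)
  then show ?thesis unfolding xz(3-6) unfolding xz(1,2)
    by (simp add: divide_simps power2_eq_square) algebra
qed

text \<open>The eigenvalue equations for all coefficients at once, as one identity of generating
  functions. The bound \<open>N\<close> is common to all permutations so that the coefficients of
  \<open>p\<close> and of its neighbours sit in the same finite sum.\<close>

lemma eigen_generating_identity:
  assumes p: "p \<in> sym_grp n" and x: "1 < x" and z: "0 < z" "z < 1"
    and N: "\<And>q. q \<in> sym_grp n \<Longrightarrow> degree (cycle_poly n q) \<le> N"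
      "\<And>q r. q \<in> sym_grp n \<Longrightarrow> degree (coeff (cycle_poly n q) r) \<le> N"
  shows "(\<Sum>r\<le>N. \<Sum>i\<le>N. ((\<Sum>(a, b)\<in>edges n. cycle_coeff n r i (Transposition.transpose a b \<circ> p))
      - (real (card (edges n)) - (real n - real r) * (real r + real i + 1)) * cycle_coeff n r i p) * x ^ r * z ^ i) = 0"
proof -
  let ?c = "cycle_coeff n"
  let ?F = "\<lambda>x z. cycle_prod n (wt x z) p"
  define T where "T x = (\<Sum>c\<in>cycles_of n p. real (card c) / wt x z (card c))" for x
  define S where "S = wt_sum_x n p x z"
  define R where "R = wt_sum_z n p x z"
  define U where "U = wt_sum_sq n p x z"
  define P1 where "P1 x = (\<Sum>r\<le>N. \<Sum>i\<le>N. (real r + real i + 1) * ?c r i p * x ^ r * z ^ i)" for x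
  define P2 where "P2 = (\<Sum>r\<le>N. \<Sum>i\<le>N. (real n - real r) * (real r + real i + 1) * ?c r i p * x ^ r * z ^ i)"
  have T: "T y = wt_sum_1 n p y z" if "1 < y" for y using wt_sum_1_def[OF p that z] by (simp add: T_def)
  have P: "poly2 (cycle_poly n q) y w = (\<Sum>r\<le>N. \<Sum>i\<le>N. ?c r i q * y ^ r * w ^ i)" if "q \<in> sym_grp n" for q y w
    unfolding cycle_coeff_def using N[OF that] by (intro poly2_coeffs)
  \<comment> \<open>\<open>P1\<close> is \<open>x d/dx + z d/dz + 1\<close> applied to the polynomial: the derivative at \<open>s = 1\<close>
    of \<open>s P(s x, s z)\<close>.\<close>
  have P1: "P1 y = ?F y z * (1 / (1 - z)\<^sup>2 + (y - 1) / ((1 - z) * (y - z)) * (real n - T y))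
      - y ^ n * ((real n + 1) / (1 - z) + z / (1 - z)\<^sup>2)" if y: "1 < y" for y
  proof -
    \<comment> \<open>The prefactor s cancels against the scaled denominator s (y - z), so the pole
      part 1 / (y - z) is constant in s and vanishes on differentiation.\<close>
    let ?f = "\<lambda>s. (s * y - 1) / ((1 - s * z) * (y - z)) * ?F (s * y) (s * z)
        - s ^ (n + 1) * y ^ n / (1 - s * z) + 1 / (y - z)"
    have yz: "y \<noteq> z" "y - z > 0" using y z by auto
    have "((\<lambda>s. \<Sum>r\<le>N. \<Sum>i\<le>N. ?c r i p * y ^ r * z ^ i * s ^ (r + i + 1)) has_real_derivative
        (\<Sum>r\<le>N. \<Sum>i\<le>N. ?c r i p * y ^ r * z ^ i * (real (r + i + 1) * 1 ^ (r + i)))) (at 1)"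
      by (intro DERIV_sum) (auto intro!: derivative_eq_intros)
    also have "(\<Sum>r\<le>N. \<Sum>i\<le>N. ?c r i p * y ^ r * z ^ i * (real (r + i + 1) * 1 ^ (r + i))) = P1 y"
      unfolding P1_def by (intro sum.cong refl) (simp add: algebra_simps)
    also have "(\<lambda>s. \<Sum>r\<le>N. \<Sum>i\<le>N. ?c r i p * y ^ r * z ^ i * s ^ (r + i + 1)) =
        (\<lambda>s. s * poly2 (cycle_poly n p) (s * y) (s * z))"
      unfolding P[OF p] by (simp add: sum_distrib_left power_mult_distrib power_add mult_ac)
    finally have "((\<lambda>s. s * poly2 (cycle_poly n p) (s * y) (s * z)) has_real_derivative P1 y) (at 1)" .
    moreover have "((\<lambda>s. s * poly2 (cycle_poly n p) (s * y) (s * z)) has_real_derivative P1 y) (at 1)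
       \<longleftrightarrow> (?f has_real_derivative P1 y) (at 1)"
    proof (rule DERIV_cong_ev[OF refl _ refl])
      have "\<forall>\<^sub>F s in nhds 1. s \<in> {0<..<1 / z}"
        using z by (intro eventually_nhds_in_open) (auto simp: divide_simps)
      then show "\<forall>\<^sub>F s in nhds 1. s * poly2 (cycle_poly n p) (s * y) (s * z) = ?f s"
      proof eventually_elim
        case (elim s)
        then have s: "s > 0" "s * z < 1" using z by (auto simp: field_simps)
        have "s * (((G - a) / D - (G - 1) / (s * E)) :: real) = s * G / D - s * a / D - (G - 1) / E"
          if "D > 0" "E > 0" for G a D E
          using that s by (simp add: field_simps)
        from this[of "1 - s * z" "y - z" "?F (s * y) (s * z)" "(s * y) ^ n"]
        have "s * poly2 (cycle_poly n p) (s * y) (s * z) =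
            s * ?F (s * y) (s * z) / (1 - s * z) - s * (s * y) ^ n / (1 - s * z) - (?F (s * y) (s * z) - 1) / (y - z)"
          using poly2_cycle_poly[OF p, of "s * y" "s * z"] s yz by (simp add: right_diff_distrib)
        also have "\<dots> = ?f s"
          using s yz by (simp add: divide_simps power_mult_distrib) (simp add: algebra_simps)
        finally show ?case .
      qed
    qed
    moreover have "(?f has_real_derivative (?F y z * (1 / (1 - z)\<^sup>2 + (y - 1) / ((1 - z) * (y - z)) * (real n - T y))
        - y ^ n * ((real n + 1) / (1 - z) + z / (1 - z)\<^sup>2))) (at 1)"
      using z yz
      by (auto intro!: derivative_eq_intros DERIV_cycle_prod_scale[OF p y z])
        (simp add: T[OF y] divide_simps, simp add: algebra_simps power2_eq_square)
    ultimately show ?thesis using DERIV_unique by blast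
  qed
  have xz: "x - z > 0" "x - 1 > 0" "1 - z > 0" using x z by auto
  have "P2 = ?F x z * ((real n - S) * (1 / (1 - z)\<^sup>2 + (x - 1) / ((1 - z) * (x - z)) * (real n - T x))
      - x / (x - z)\<^sup>2 * (real n - T x) - (x - 1) / ((1 - z) * (x - z)) * U)"
  proof -
    define D where "D = (\<Sum>r\<le>N. \<Sum>i\<le>N. (real r + real i + 1) * ?c r i p * (real r * x ^ (r - 1)) * z ^ i)"
    have D: "(P1 has_real_derivative D) (at x)"
      unfolding P1_def D_def by (intro DERIV_sum) (auto intro!: derivative_eq_intros simp: mult_ac)
    \<comment> \<open>The second factor n - A, applied to the closed form of
      \<open>P1\<close>.\<close>
    have "P2 = real n * P1 x - x * D"
      unfolding P2_def P1_def D_def sum_distrib_left sum_subtractf[symmetric]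
    proof (intro sum.cong refl)
      fix r i
      have "x * (real r * x ^ (r - 1)) = real r * x ^ r" by (cases r) auto
      then have "x * ((real r + real i + 1) * ?c r i p * (real r * x ^ (r - 1)) * z ^ i) =
          (real r + real i + 1) * ?c r i p * (real r * x ^ r) * z ^ i"
        by (metis mult.assoc mult.left_commute)
      then show "(real n - real r) * (real r + real i + 1) * ?c r i p * x ^ r * z ^ i =
          real n * ((real r + real i + 1) * ?c r i p * x ^ r * z ^ i) -
          x * ((real r + real i + 1) * ?c r i p * (real r * x ^ (r - 1)) * z ^ i)"
        by (simp add: algebra_simps)
    qed
    let ?g = "\<lambda>y. ?F y z * (1 / (1 - z)\<^sup>2 + (y - 1) / ((1 - z) * (y - z)) * (real n - T y))
      - y ^ n * ((real n + 1) / (1 - z) + z / (1 - z)\<^sup>2)"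
    have "(P1 has_real_derivative D) (at x) \<longleftrightarrow> (?g has_real_derivative D) (at x)"
    proof (rule DERIV_cong_ev[OF refl _ refl])
      have "\<forall>\<^sub>F y in nhds x. y \<in> {1<..}" using x by (intro eventually_nhds_in_open) auto
      then show "\<forall>\<^sub>F y in nhds x. P1 y = ?g y"
        by eventually_elim (use P1 in auto)
    qed
    moreover have "(?g has_real_derivative
        (?F x z * S / x * (1 / (1 - z)\<^sup>2 + (x - 1) / ((1 - z) * (x - z)) * (real n - T x))
         + ?F x z * (1 / (x - z)\<^sup>2 * (real n - T x) + (x - 1) / ((1 - z) * (x - z)) * (U / x))
         - real n * x ^ n / x * ((real n + 1) / (1 - z) + z / (1 - z)\<^sup>2))) (at x)"
    proof -
      have dH: "((\<lambda>y. (y - 1) / ((1 - z) * (y - z))) has_real_derivative 1 / (x - z)\<^sup>2) (at x)"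
        using xz by (auto intro!: derivative_eq_intros) (simp add: divide_simps, simp add: algebra_simps power2_eq_square)
      have dT: "(T has_real_derivative - U / x) (at x)"
        unfolding T_def U_def by (rule DERIV_wt_sum_1[OF p x z])
      have dF: "((\<lambda>y. ?F y z) has_real_derivative ?F x z * S / x) (at x)"
        unfolding S_def by (rule DERIV_cycle_prod_x[OF p x z])
      have dn: "((\<lambda>y. y ^ n) has_real_derivative real n * x ^ n / x) (at x)"
      proof -
        have "real n * x ^ (n - 1) = real n * x ^ n / x" using x by (cases n) auto
        then show ?thesis by (auto intro!: derivative_eq_intros)
      qed
      show ?thesis
        by (rule DERIV_cong, rule DERIV_diff, rule DERIV_mult, rule dF, rule DERIV_add, rule DERIV_const,
            rule DERIV_mult, rule dH, rule DERIV_diff, rule DERIV_const, rule dT,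
            rule DERIV_cmult_right, rule dn)
          (simp add: algebra_simps)
    qed
    ultimately have D_eq: "D = ?F x z * S / x * (1 / (1 - z)\<^sup>2 + (x - 1) / ((1 - z) * (x - z)) * (real n - T x))
         + ?F x z * (1 / (x - z)\<^sup>2 * (real n - T x) + (x - 1) / ((1 - z) * (x - z)) * (U / x))
         - real n * x ^ n / x * ((real n + 1) / (1 - z) + z / (1 - z)\<^sup>2)"
      using D DERIV_unique by blast
    then have "x * D = ?F x z * S * (1 / (1 - z)\<^sup>2 + (x - 1) / ((1 - z) * (x - z)) * (real n - T x))
         + ?F x z * (x / (x - z)\<^sup>2 * (real n - T x) + (x - 1) / ((1 - z) * (x - z)) * U)
         - real n * x ^ n * ((real n + 1) / (1 - z) + z / (1 - z)\<^sup>2)"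
    proof -
      have "x * (a / x * G + F * (1 / d * w + h * (U / x)) - b / x * g) = a * G + F * (x / d * w + h * U) - b * g"
        for a b d w h g G F :: real
        using x by (simp add: distrib_left right_diff_distrib)
      then show ?thesis unfolding D_eq .
    qed
    \<comment> \<open>Here the multiple of x^n disappears, being annihilated by n - A.\<close>
    moreover have "l * (F * G - y * g) - (F * S * G + F * (e + f) - l * y * g) = F * ((l - S) * G - e - f)"
      for l F G y g S e f :: real
      by (simp add: algebra_simps)
    ultimately show ?thesis
      unfolding \<open>P2 = real n * P1 x - x * D\<close> P1[OF x] by (simp only:)
  qed
  moreover define H K where "H = (x - 1) / ((1 - z) * (x - z))" and "K = 1 / (x - z) - x ^ n / (1 - z)"
  ultimately have P2: "P2 = ?F x z * ((real n - S) * (1 / (1 - z)\<^sup>2 + H * (real n - T x))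
      - x / (x - z)\<^sup>2 * (real n - T x) - H * U)" by simp
  have ev: "poly2 (cycle_poly n q) x z = H * cycle_prod n (wt x z) q + K" if "q \<in> sym_grp n" for q
    using poly2_cycle_poly[OF that, of x z] xz unfolding H_def K_def
    by (simp add: divide_simps) (simp add: algebra_simps)
  have "2 * (\<Sum>(a, b)\<in>edges n. poly2 (cycle_poly n (Transposition.transpose a b \<circ> p)) x z) =
      2 * (\<Sum>(a, b)\<in>edges n. H * cycle_prod n (wt x z) (Transposition.transpose a b \<circ> p) + K)"
    using transpose_comp_in_sym_grp[of _ _ n p] p by (auto intro!: sum.cong ev)
  also have "\<dots> = H * (2 * (\<Sum>(a, b)\<in>edges n. cycle_prod n (wt x z) (Transposition.transpose a b \<circ> p)))
      + 2 * real (card (edges n)) * K"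
    by (simp add: case_prod_unfold sum.distrib sum_distrib_left mult_ac)
  finally have E: "2 * (\<Sum>(a, b)\<in>edges n. poly2 (cycle_poly n (Transposition.transpose a b \<circ> p)) x z) =
      H * (?F x z * (S\<^sup>2 + (T x)\<^sup>2 - R\<^sup>2 + 2 * U - (S + T x + R)
      + 2 * (S - x * T x) / (x - 1) - 2 * (z * S - x * R) / (x - z) - 2 * (R - z * T x) / (z - 1)))
      + 2 * real (card (edges n)) * K"
    unfolding sum_edges_wt[OF p x z] S_def R_def U_def T[OF x] .
  \<comment> \<open>Eliminating \<open>wt_sum_z\<close> leaves only quantities reachable through
    scaling and x-derivatives.\<close>
  have R: "R = S + T x - n"
    using sums_total[OF p x z] unfolding S_def R_def T[OF x] by simp
  have alg: "H * (S\<^sup>2 + (T x)\<^sup>2 - R\<^sup>2 + 2 * U - (S + T x + R)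
      + 2 * (S - x * T x) / (x - 1) - 2 * (z * S - x * R) / (x - z) - 2 * (R - z * T x) / (z - 1))
    - real n * (real n - 1) * H
    + 2 * ((real n - S) * (1 / (1 - z)\<^sup>2 + H * (real n - T x)) - x / (x - z)\<^sup>2 * (real n - T x) - H * U) = 0"
    unfolding R H_def using xz by (rule edge_sum_identity)
  have "2 * ((\<Sum>(a, b)\<in>edges n. poly2 (cycle_poly n (Transposition.transpose a b \<circ> p)) x z)
      - real (card (edges n)) * poly2 (cycle_poly n p) x z + P2) =
    ?F x z * (H * (S\<^sup>2 + (T x)\<^sup>2 - R\<^sup>2 + 2 * U - (S + T x + R)
      + 2 * (S - x * T x) / (x - 1) - 2 * (z * S - x * R) / (x - z) - 2 * (R - z * T x) / (z - 1))
    - real n * (real n - 1) * H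
    + 2 * ((real n - S) * (1 / (1 - z)\<^sup>2 + H * (real n - T x)) - x / (x - z)\<^sup>2 * (real n - T x) - H * U))"
    unfolding distrib_left[of 2] right_diff_distrib[of 2] E ev[OF p] P2 card_edges[symmetric]
    by (simp add: algebra_simps)
  then have "(\<Sum>(a, b)\<in>edges n. poly2 (cycle_poly n (Transposition.transpose a b \<circ> p)) x z)
      - real (card (edges n)) * poly2 (cycle_poly n p) x z + P2 = 0"
    unfolding alg by simp
  moreover have "(\<Sum>(a, b)\<in>edges n. poly2 (cycle_poly n (Transposition.transpose a b \<circ> p)) x z) =
      (\<Sum>r\<le>N. \<Sum>i\<le>N. (\<Sum>(a, b)\<in>edges n. ?c r i (Transposition.transpose a b \<circ> p)) * x ^ r * z ^ i)"
  proof -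
    have "(\<Sum>(a, b)\<in>edges n. poly2 (cycle_poly n (Transposition.transpose a b \<circ> p)) x z) =
      (\<Sum>(a, b)\<in>edges n. \<Sum>r\<le>N. \<Sum>i\<le>N. ?c r i (Transposition.transpose a b \<circ> p) * x ^ r * z ^ i)"
      using transpose_comp_in_sym_grp[of _ _ n p] p by (auto intro!: sum.cong P)
    also have "\<dots> = (\<Sum>r\<le>N. \<Sum>i\<le>N. \<Sum>(a, b)\<in>edges n. ?c r i (Transposition.transpose a b \<circ> p) * x ^ r * z ^ i)"
      unfolding case_prod_unfold by (subst sum.swap) (intro sum.cong refl sum.swap)
    finally show ?thesis by (simp add: sum_distrib_right case_prod_unfold)
  qed
  ultimately show ?thesis
    unfolding P[OF p] P2_def
    by (simp add: sum_distrib_left sum_subtractf[symmetric] sum.distrib[symmetric] algebra_simps)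
qed

subsection \<open>The exact expectation\<close>

lemma ex_uniform_degree_bound:
  "\<exists>N\<ge>M. \<forall>q\<in>sym_grp n. degree (cycle_poly n q) \<le> N \<and> (\<forall>r. degree (coeff (cycle_poly n q) r) \<le> N)"
proof -
  have "\<forall>q. \<exists>N. degree (cycle_poly n q) \<le> N \<and> (\<forall>r. degree (coeff (cycle_poly n q) r) \<le> N)"
    using poly2_degree_bound by blast
  then obtain D where D: "degree (cycle_poly n q) \<le> D q" "degree (coeff (cycle_poly n q) r) \<le> D q" for q r
    by metis
  have "D q \<le> M + (\<Sum>q\<in>sym_grp n. D q)" if "q \<in> sym_grp n" for q
    using member_le_sum[OF that, of D] finite_sym_grp[of n] by simp
  then show ?thesis
    by (intro exI[of _ "M + (\<Sum>q\<in>sym_grp n. D q)"]) (meson D le_add1 le_trans)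
qed

lemma cycle_coeff_eigen:
  assumes "p \<in> sym_grp n"
  shows "(\<Sum>(a, b)\<in>edges n. cycle_coeff n r i (Transposition.transpose a b \<circ> p)) =
    (real (card (edges n)) - (real n - real r) * (real r + real i + 1)) * cycle_coeff n r i p"
proof -
  obtain N where N: "r + i \<le> N" "\<And>q. q \<in> sym_grp n \<Longrightarrow> degree (cycle_poly n q) \<le> N"
      "\<And>q r. q \<in> sym_grp n \<Longrightarrow> degree (coeff (cycle_poly n q) r) \<le> N"
    using ex_uniform_degree_bound[of "r + i" n] by blast
  have "(\<Sum>(a, b)\<in>edges n. cycle_coeff n r i (Transposition.transpose a b \<circ> p)) -
    (real (card (edges n)) - (real n - real r) * (real r + real i + 1)) * cycle_coeff n r i p = 0"
    by (rule double_sum_coeffs_zero[where N = N and c = "\<lambda>r i. (\<Sum>(a, b)\<in>edges n. cycle_coeff n r i (Transposition.transpose a b \<circ> p)) -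
        (real (card (edges n)) - (real n - real r) * (real r + real i + 1)) * cycle_coeff n r i p"])
      (use eigen_generating_identity[OF assms _ _ _ N(2,3)] N(1) in auto)
  then show ?thesis by simp
qed

section \<open>Expectations of eigenfunctions\<close>

lemma pmf_interchange_law':
  assumes "0 \<le> t"
  shows "pmf (interchange_law n t) s =
    (\<Sum>j. t ^ j * fact_count n j s / fact j) * exp (- t * real (card (edges n)))"
  using pmf_interchange_law[OF assms, of n s] unfolding ga_exp_interchange_gen of_real_eq_iff .

lemma expectation_interchange_law:
  assumes "0 \<le> t"
  shows "measure_pmf.expectation (interchange_law n t) f = (\<Sum>s\<in>sym_grp n. f s * pmf (interchange_law n t) s)"
proof (rule integral_measure_pmf_real[OF finite_sym_grp])
  fix s assume "s \<in> set_pmf (interchange_law n t)"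
  then show "s \<in> sym_grp n"
    by (rule contrapos_pp) (simp add: set_pmf_iff pmf_interchange_law'[OF assms] fact_count_outside)
qed

text \<open>The law is a Poisson mixture of products of transpositions. Pairing \<open>f\<close>
  with \<open>fact_count\<close> gains a factor \<open>l\<close> per transposition, and the
  exponential series collects these factors.\<close>

lemma expectation_eigenfunction:
  fixes f :: "(nat \<Rightarrow> nat) \<Rightarrow> real"
  assumes t: "0 \<le> t"
    and f: "\<And>s. s \<in> sym_grp n \<Longrightarrow> (\<Sum>(i, j)\<in>edges n. f (Transposition.transpose i j \<circ> s)) = l * f s"
  shows "measure_pmf.expectation (interchange_law n t) f = exp (t * (l - real (card (edges n)))) * f id"
proof -
  have step: "(\<Sum>s\<in>sym_grp n. f s * fact_count n j s) = l ^ j * f id" for j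
  proof (induction j)
    case 0
    have delta: "(\<Sum>s\<in>S. f s * of_bool (s = e)) = f e" if "finite S" "e \<in> S" for S e
      using that by (simp add: of_bool_def if_distrib cong: if_cong)
    show ?case
      by (simp only: fact_count.simps power_0 mult_1 delta[OF finite_sym_grp id_in_sym_grp])
  next
    case (Suc j)
    have "(\<Sum>s\<in>sym_grp n. f s * fact_count n (Suc j) s) =
        (\<Sum>e\<in>edges n. \<Sum>s\<in>sym_grp n. f s * fact_count n j (Transposition.transpose (fst e) (snd e) \<circ> s))"
      by (simp add: case_prod_unfold sum_distrib_left sum.swap[of _ "sym_grp n"])
    \<comment> \<open>Reindexing by an involution moves the transposition from
      \<open>fact_count\<close> to \<open>f\<close>.\<close>
    also have "\<dots> = (\<Sum>e\<in>edges n. \<Sum>s\<in>sym_grp n. f (Transposition.transpose (fst e) (snd e) \<circ> s) * fact_count n j s)"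
    proof (rule sum.cong[OF refl])
      fix e assume "e \<in> edges n"
      then have e: "(fst e, snd e) \<in> edges n" by simp
      show "(\<Sum>s\<in>sym_grp n. f s * fact_count n j (Transposition.transpose (fst e) (snd e) \<circ> s)) =
          (\<Sum>s\<in>sym_grp n. f (Transposition.transpose (fst e) (snd e) \<circ> s) * fact_count n j s)"
        by (rule sum.reindex_bij_witness[where i = "\<lambda>s. Transposition.transpose (fst e) (snd e) \<circ> s"
              and j = "\<lambda>s. Transposition.transpose (fst e) (snd e) \<circ> s"])
          (simp_all add: transpose_comp_in_sym_grp[OF e] comp_assoc[symmetric])
    qed
    also have "\<dots> = (\<Sum>s\<in>sym_grp n. (\<Sum>(i, j)\<in>edges n. f (Transposition.transpose i j \<circ> s)) * fact_count n j s)"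
      by (simp add: case_prod_unfold sum_distrib_right sum.swap[of _ "sym_grp n"])
    also have "\<dots> = (\<Sum>s\<in>sym_grp n. l * (f s * fact_count n j s))"
      by (intro sum.cong refl) (simp add: f)
    also have "\<dots> = l ^ Suc j * f id" by (simp only: sum_distrib_left[symmetric] Suc power_Suc mult.assoc)
    finally show ?case .
  qed
  have "(\<lambda>j. \<Sum>s\<in>sym_grp n. f s * (t ^ j * fact_count n j s / fact j)) sums
      (\<Sum>s\<in>sym_grp n. f s * (\<Sum>j. t ^ j * fact_count n j s / fact j))"
    by (intro sums_sum sums_mult summable_sums summable_norm_cancel[OF fact_count_summable])
  moreover have "(\<Sum>s\<in>sym_grp n. f s * (t ^ j * fact_count n j s / fact j)) =
      ((t * l) ^ j /\<^sub>R fact j) * f id" for j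
  proof -
    have "(\<Sum>s\<in>sym_grp n. f s * (t ^ j * fact_count n j s / fact j)) =
        t ^ j / fact j * (\<Sum>s\<in>sym_grp n. f s * fact_count n j s)"
      by (simp add: sum_distrib_left mult_ac)
    then show ?thesis unfolding step by (simp add: power_mult_distrib divide_inverse)
  qed
  ultimately have "(\<lambda>j. ((t * l) ^ j /\<^sub>R fact j) * f id) sums
      (\<Sum>s\<in>sym_grp n. f s * (\<Sum>j. t ^ j * fact_count n j s / fact j))" by simp
  moreover have "(\<lambda>j. ((t * l) ^ j /\<^sub>R fact j) * f id) sums (exp (t * l) * f id)"
    by (intro sums_mult2 exp_converges)
  ultimately have "(\<Sum>s\<in>sym_grp n. f s * (\<Sum>j. t ^ j * fact_count n j s / fact j)) = exp (t * l) * f id"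
    using sums_unique2 by blast
  then have "measure_pmf.expectation (interchange_law n t) f =
      exp (t * l) * f id * exp (- t * real (card (edges n)))"
    unfolding expectation_interchange_law[OF t] pmf_interchange_law'[OF t]
    by (simp add: mult.assoc[symmetric] sum_distrib_right[symmetric])
  then show ?thesis by (simp add: exp_diff exp_minus right_diff_distrib field_simps)
qed

section \<open>The coefficients at z = 1 and at the identity permutation\<close>

lemma coeff_slice: "coeff (map_poly (\<lambda>c. poly c z) P) m = poly (coeff P m) z"
  by (simp add: coeff_map_poly)

text \<open>At z = 1 a cycle of length l contributes l x^(n - l), so x^(n - k) collects exactly the
  cycles of length \<open>k\<close>. The -1 comes from the geometric sum over powers below n, which
  contains this power because \<open>1 \<le> k\<close>.\<close>

lemma cycle_coeff_sum_one:
  assumes p: "p \<in> sym_grp n" and k: "1 \<le> k" "k \<le> n"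
  shows "poly (coeff (cycle_poly n p) (n - k)) 1 = real k * real (cycle_count n k p) - 1"
proof -
  let ?C = "cycles_of n p"
  have le: "card c \<le> n" if "c \<in> ?C" for c
    using card_mono[OF _ cycles_of_subset[OF p that]] by simp
  have "map_poly (\<lambda>c. poly c 1) (cycle_poly n p) =
      (\<Sum>c\<in>?C. monom (real (card c)) (n - card c)) - (\<Sum>r<n. monom 1 r)"
  proof (rule poly_eqI_infinite)
    show "infinite {1 :: real<..}" by (rule infinite_Ioi)
    fix x :: real assume "x \<in> {1<..}"
    then show "poly (map_poly (\<lambda>c. poly c 1) (cycle_poly n p)) x =
        poly ((\<Sum>c\<in>?C. monom (real (card c)) (n - card c)) - (\<Sum>r<n. monom 1 r)) x"
      unfolding poly2_slice[symmetric] by (simp add: poly2_cycle_poly_one[OF p] poly_sum poly_monom sum_gp_strict field_simps)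
  qed
  then have "poly (coeff (cycle_poly n p) (n - k)) 1 =
      coeff ((\<Sum>c\<in>?C. monom (real (card c)) (n - card c)) - (\<Sum>r<n. monom 1 r)) (n - k)"
    by (simp add: coeff_slice[symmetric])
  also have "\<dots> = (\<Sum>c\<in>?C. if n - card c = n - k then real (card c) else 0) - 1"
    using k by (simp add: coeff_sum)
  also have "(\<Sum>c\<in>?C. if n - card c = n - k then real (card c) else 0) = (\<Sum>c\<in>?C. if card c = k then real k else 0)"
  proof (intro sum.cong refl)
    fix c assume "c \<in> ?C"
    then have "n - card c = n - k \<longleftrightarrow> card c = k" using le[of c] k by arith
    then show "(if n - card c = n - k then real (card c) else 0) = (if card c = k then real k else 0)" by simp
  qed
  also have "\<dots> = real k * real (cycle_count n k p)"
  proof -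
    have "cycle_count n k p = card {c \<in> ?C. card c = k}" by (simp only: cycle_count_def cycles_of_def)
    then show ?thesis by (simp add: sum.If_cases finite_cycles_of Int_def)
  qed
  finally show ?thesis .
qed

lemma cycle_prod_id: "cycle_prod n w id = w 1 ^ n"
proof -
  have "orbit id i = {i}" for i :: nat by (simp add: orbit_eq_singleton_iff)
  then have "cycles_of n id = (\<lambda>i. {i}) ` {1..n}" by (simp add: cycles_of_def)
  then show ?thesis by (simp add: cycle_prod_def prod.reindex)
qed

text \<open>At the identity F is (x + (1 - z))^n. Its binomial expansion divides termwise in both
  parts: \<open>A\<close> is (F - x^n) / (1 - z) and \<open>B\<close> is (F - 1) / (x - z).\<close>

lemma cycle_poly_id:
  assumes m: "m < n"
  shows "poly (coeff (cycle_poly n id) m) z =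
    real (n choose m) * (1 - z) ^ (n - m - 1) - (\<Sum>r\<in>{m<..n}. real (n choose r) * z ^ (r - m - 1) * (1 - z) ^ (n - r))"
proof -
  define R :: "real poly" where "R = smult (real (n choose m)) ([:1, -1:] ^ (n - m - 1))
      - (\<Sum>r\<in>{m<..n}. smult (real (n choose r)) ([:0, 1:] ^ (r - m - 1) * [:1, -1:] ^ (n - r)))"
  have R: "poly R z = real (n choose m) * (1 - z) ^ (n - m - 1) - (\<Sum>r\<in>{m<..n}. real (n choose r) * z ^ (r - m - 1) * (1 - z) ^ (n - r))" for z
    by (simp add: R_def poly_sum mult.assoc)
  have "coeff (cycle_poly n id) m = R"
  proof (rule poly_eqI_infinite)
    show "infinite {0 <..< 1 :: real}" by (rule infinite_Ioo) simp
    fix z :: real assume z: "z \<in> {0<..<1}"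
    define A where "A = (\<Sum>r<n. monom (real (n choose r) * (1 - z) ^ (n - r - 1)) r)"
    define B where "B = (\<Sum>r\<le>n. \<Sum>j<r. monom (real (n choose r) * (1 - z) ^ (n - r) * z ^ (r - Suc j)) j)"
    have "map_poly (\<lambda>c. poly c z) (cycle_poly n id) = A - B"
    proof (rule poly_eqI_infinite)
      show "infinite {1 :: real<..}" by (rule infinite_Ioi)
      fix x :: real assume x: "x \<in> {1<..}"
      have bin: "(y + (1 - z)) ^ n = (\<Sum>r\<le>n. real (n choose r) * y ^ r * (1 - z) ^ (n - r))" for y
        by (rule binomial_ring)
      have "(1 - z) * poly A x = (\<Sum>r<n. real (n choose r) * x ^ r * (1 - z) ^ (n - r))"
        unfolding A_def poly_sum poly_monom sum_distrib_left
      proof (intro sum.cong refl)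
        fix r assume "r \<in> {..<n}"
        then have "n - r = Suc (n - r - 1)" by auto
        then have "(1 - z) ^ (n - r) = (1 - z) * (1 - z) ^ (n - r - 1)" by (metis power_Suc)
        then show "(1 - z) * (real (n choose r) * (1 - z) ^ (n - r - 1) * x ^ r) = real (n choose r) * x ^ r * (1 - z) ^ (n - r)"
          by simp
      qed
      also have "\<dots> = (x + (1 - z)) ^ n - x ^ n" unfolding bin by (simp flip: lessThan_Suc_atMost)
      finally have A: "poly A x = ((x + (1 - z)) ^ n - x ^ n) / (1 - z)" using z by (simp add: field_simps)
      \<comment> \<open>Writing 1 as (z + (1 - z))^n turns F - 1 into a combination of the
        differences x^r - z^r, each divisible by x - z.\<close>
      have "(x - z) * poly B x = (\<Sum>r\<le>n. real (n choose r) * (1 - z) ^ (n - r) * ((x - z) * (\<Sum>j<r. z ^ (r - Suc j) * x ^ j)))"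
        unfolding B_def poly_sum poly_monom by (simp add: sum_distrib_left mult_ac)
      also have "\<dots> = (\<Sum>r\<le>n. real (n choose r) * x ^ r * (1 - z) ^ (n - r)) - (\<Sum>r\<le>n. real (n choose r) * z ^ r * (1 - z) ^ (n - r))"
        unfolding power_diff_sumr2[symmetric] sum_subtractf[symmetric]
        by (intro sum.cong refl) (simp add: algebra_simps)
      also have "\<dots> = (x + (1 - z)) ^ n - 1" unfolding bin[symmetric] by simp
      finally have B: "poly B x = ((x + (1 - z)) ^ n - 1) / (x - z)" using z x by (simp add: field_simps)
      show "poly (map_poly (\<lambda>c. poly c z) (cycle_poly n id)) x = poly (A - B) x"
        unfolding poly2_slice[symmetric] using x z
        by (simp add: poly2_cycle_poly[OF id_in_sym_grp] cycle_prod_id wt_def A B add_diff_eq)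
    qed
    then have "poly (coeff (cycle_poly n id) m) z = coeff A m - coeff B m"
      by (simp add: coeff_slice[symmetric])
    also have "coeff A m = real (n choose m) * (1 - z) ^ (n - m - 1)"
      using m by (simp add: A_def coeff_sum)
    also have "coeff B m = (\<Sum>r\<le>n. if m < r then real (n choose r) * (1 - z) ^ (n - r) * z ^ (r - Suc m) else 0)"
      unfolding B_def coeff_sum coeff_monom by (intro sum.cong refl) simp
    also have "\<dots> = (\<Sum>r\<in>{m<..n}. real (n choose r) * z ^ (r - m - 1) * (1 - z) ^ (n - r))"
      by (intro sum.mono_neutral_cong_right) auto
    finally show "poly (coeff (cycle_poly n id) m) z = poly R z" unfolding R .
  qed
  then show ?thesis using R by simp
qed

theorem expectation_cycle_count:
  assumes k: "1 \<le> k" "k \<le> n" and t: "0 \<le> t"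
  defines "q \<equiv> exp (- (real k * t))" and "m \<equiv> n - k"
  shows "real k * measure_pmf.expectation (interchange_law n t) (\<lambda>\<sigma>. real (cycle_count n k \<sigma>)) =
    real (n choose m) * q ^ (m + 1) * (1 - q) ^ (k - 1) +
      (\<Sum>r\<le>m. real (n choose r) * q ^ r * (1 - q) ^ (n - r))"
proof -
  obtain N where N: "\<And>q. q \<in> sym_grp n \<Longrightarrow> degree (coeff (cycle_poly n q) m) \<le> N"
    using ex_uniform_degree_bound[of 0 n] by blast
  let ?E = "\<lambda>f. measure_pmf.expectation (interchange_law n t) f"
  have total: "(\<Sum>s\<in>sym_grp n. pmf (interchange_law n t) s) = 1"
    using expectation_interchange_law[OF t, of n "\<lambda>_. 1"] by simp
  have "real k * ?E (\<lambda>\<sigma>. real (cycle_count n k \<sigma>)) =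
      (\<Sum>s\<in>sym_grp n. real k * real (cycle_count n k s) * pmf (interchange_law n t) s)"
    unfolding expectation_interchange_law[OF t] by (simp add: sum_distrib_left mult_ac)
  also have "\<dots> = (\<Sum>s\<in>sym_grp n. (1 + (\<Sum>i\<le>N. cycle_coeff n m i s)) * pmf (interchange_law n t) s)"
  proof (intro sum.cong refl)
    fix s assume s: "s \<in> sym_grp n"
    have "real k * real (cycle_count n k s) = 1 + (\<Sum>i\<le>N. cycle_coeff n m i s)"
      using cycle_coeff_sum_one[OF s k] poly_eq_sum_bound[OF N[OF s], of 1]
      by (simp add: cycle_coeff_def m_def)
    then show "real k * real (cycle_count n k s) * pmf (interchange_law n t) s =
        (1 + (\<Sum>i\<le>N. cycle_coeff n m i s)) * pmf (interchange_law n t) s" by simp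
  qed
  also have "\<dots> = 1 + (\<Sum>i\<le>N. \<Sum>s\<in>sym_grp n. cycle_coeff n m i s * pmf (interchange_law n t) s)"
    by (simp add: distrib_right sum.distrib total sum_distrib_right sum.swap[of _ "sym_grp n"])
  also have "\<dots> = 1 + (\<Sum>i\<le>N. ?E (cycle_coeff n m i))"
    unfolding expectation_interchange_law[OF t] ..
  also have "\<dots> = 1 + (\<Sum>i\<le>N. q ^ (m + 1) * (cycle_coeff n m i id * q ^ i))"
  proof -
    have "?E (cycle_coeff n m i) = q ^ (m + 1) * (cycle_coeff n m i id * q ^ i)" for i
    proof -
      have "q ^ (m + 1 + i) = exp (real (m + 1 + i) * - (real k * t))"
        unfolding q_def by (rule exp_of_nat_mult[symmetric])
      \<comment> \<open>As n - m = k, the rate is k (m + 1 + i); the factors \<open>q ^ i\<close>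
        then turn the sum over \<open>i\<close> into evaluation at z = q.\<close>
      moreover have "t * ((real (card (edges n)) - (real n - real m) * (real m + real i + 1)) - real (card (edges n))) =
          real (m + 1 + i) * - (real k * t)"
        using k by (simp add: m_def of_nat_diff algebra_simps)
      ultimately have "?E (cycle_coeff n m i) = q ^ (m + 1 + i) * cycle_coeff n m i id"
        using expectation_eigenfunction[OF t cycle_coeff_eigen, of n m i] by (simp only:)
      then show ?thesis by (simp only: power_add mult_ac)
    qed
    then show ?thesis by simp
  qed
  also have "\<dots> = 1 + q ^ (m + 1) * poly (coeff (cycle_poly n id) m) q"
    using poly_eq_sum_bound[OF N[OF id_in_sym_grp], of q] by (simp add: sum_distrib_left cycle_coeff_def)
  also have "\<dots> = 1 + real (n choose m) * q ^ (m + 1) * (1 - q) ^ (k - 1) -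
      (\<Sum>r\<in>{m<..n}. real (n choose r) * q ^ r * (1 - q) ^ (n - r))"
  proof -
    have "q ^ (m + 1) * (\<Sum>r\<in>{m<..n}. real (n choose r) * q ^ (r - m - 1) * (1 - q) ^ (n - r)) =
        (\<Sum>r\<in>{m<..n}. real (n choose r) * q ^ r * (1 - q) ^ (n - r))"
      unfolding sum_distrib_left
    proof (intro sum.cong refl)
      fix r assume "r \<in> {m<..n}"
      then have "q ^ r = q ^ (m + 1) * q ^ (r - m - 1)" by (simp flip: power_add power_Suc)
      then show "q ^ (m + 1) * (real (n choose r) * q ^ (r - m - 1) * (1 - q) ^ (n - r)) =
          real (n choose r) * q ^ r * (1 - q) ^ (n - r)" by simp
    qed
    moreover have "n - m - 1 = k - 1" "m < n" using k by (auto simp: m_def)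
    ultimately show ?thesis by (simp only: cycle_poly_id right_diff_distrib) (simp add: mult_ac)
  qed
  finally have E: "real k * ?E (\<lambda>\<sigma>. real (cycle_count n k \<sigma>)) =
      1 + real (n choose m) * q ^ (m + 1) * (1 - q) ^ (k - 1) -
      (\<Sum>r\<in>{m<..n}. real (n choose r) * q ^ r * (1 - q) ^ (n - r))" .
  \<comment> \<open>Total binomial mass 1 trades the subtracted upper tail for the lower
    one.\<close>
  have "1 = (\<Sum>r\<le>n. real (n choose r) * q ^ r * (1 - q) ^ (n - r))"
    using binomial_ring[of q "1 - q" n] by simp
  also have "(\<Sum>r\<le>n. real (n choose r) * q ^ r * (1 - q) ^ (n - r)) =
      (\<Sum>r\<le>m. real (n choose r) * q ^ r * (1 - q) ^ (n - r)) +
      (\<Sum>r\<in>{m<..n}. real (n choose r) * q ^ r * (1 - q) ^ (n - r))"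
  proof -
    have "{..n} = {..m} \<union> {m<..n}" by (auto simp: m_def)
    then show ?thesis by (simp only:) (rule sum.union_disjoint, auto)
  qed
  finally show ?thesis unfolding E by linarith
qed

subsection \<open>Tail bounds\<close>

text \<open>Source of the constant 1/4. For \<open>\<tau> \<le> 2\<close> the bound 1 - \<tau>/2
  \<le> exp (- \<tau>/2) has a nonnegative left side and may be squared; beyond 2 the linear part
  alone exceeds 1.\<close>

lemma exp_minus_lower:
  fixes \<tau> :: real
  shows "min (\<tau>\<^sup>2) 1 / 4 \<le> \<tau> - 1 + exp (- \<tau>)"
proof (cases "\<tau> \<le> 2")
  case True
  have "exp (- \<tau>) = (exp (- \<tau> / 2))\<^sup>2" by (simp flip: exp_double)
  moreover have "(1 - \<tau> / 2)\<^sup>2 \<le> (exp (- \<tau> / 2))\<^sup>2"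
    using exp_ge_add_one_self[of "- \<tau> / 2"] True by (intro power_mono) auto
  ultimately have "\<tau>\<^sup>2 / 4 \<le> \<tau> - 1 + exp (- \<tau>)"
    by (simp add: power2_eq_square algebra_simps)
  then show ?thesis by (smt (verit) divide_right_mono min.cobounded1)
next
  case False
  have "min (\<tau>\<^sup>2) 1 \<le> 1" by simp
  moreover have "exp (- \<tau>) > 0" by simp
  ultimately show ?thesis using False by linarith
qed

text \<open>Tilting by \<open>s\<close> makes every selected term at most the corresponding term of the expansion of
  \<open>(q s + (1 - q))^n\<close>, up to the factor \<open>s^(-m)\<close>.\<close>

lemma binomial_tail_le:
  fixes q s :: real
  assumes q: "0 \<le> q" "q \<le> 1" and s: "0 < s" and A: "A \<subseteq> {..n}"
    and le: "\<And>r. r \<in> A \<Longrightarrow> s ^ m \<le> s ^ r"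
  shows "s ^ m * (\<Sum>r\<in>A. real (n choose r) * q ^ r * (1 - q) ^ (n - r)) \<le> exp (real n * (q * s - q))"
proof -
  have "s ^ m * (\<Sum>r\<in>A. real (n choose r) * q ^ r * (1 - q) ^ (n - r)) \<le>
      (\<Sum>r\<in>A. real (n choose r) * (q * s) ^ r * (1 - q) ^ (n - r))"
    unfolding sum_distrib_left
  proof (rule sum_mono)
    fix r assume "r \<in> A"
    then have "s ^ m * (real (n choose r) * q ^ r * (1 - q) ^ (n - r)) \<le>
        s ^ r * (real (n choose r) * q ^ r * (1 - q) ^ (n - r))"
      using le q by (intro mult_right_mono) auto
    then show "s ^ m * (real (n choose r) * q ^ r * (1 - q) ^ (n - r)) \<le>
        real (n choose r) * (q * s) ^ r * (1 - q) ^ (n - r)"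
      by (simp add: power_mult_distrib mult_ac)
  qed
  also have "\<dots> \<le> (\<Sum>r\<le>n. real (n choose r) * (q * s) ^ r * (1 - q) ^ (n - r))"
    using A q s by (intro sum_mono2) auto
  also have "\<dots> = (q * s + (1 - q)) ^ n" by (rule binomial_ring[symmetric])
  also have "\<dots> \<le> exp (q * s - q) ^ n"
  proof (rule power_mono)
    show "q * s + (1 - q) \<le> exp (q * s - q)" using exp_ge_add_one_self[of "q * s - q"] by linarith
    show "0 \<le> q * s + (1 - q)" using q s by simp
  qed
  also have "\<dots> = exp (real n * (q * s - q))" by (rule exp_of_nat_mult[symmetric])
  finally show ?thesis .
qed

text \<open>The tilt \<open>s\<close> satisfies q s = m / (n - 1), which minimises s^(-m) exp ((n -
  1) (q s - q)), the bound for n - 1 trials; its value there is \<open>D\<close>. This is why n - 1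
  enters the critical time: the isolated binomial term is governed by n - 1 trials.\<close>

lemma cycle_count_tail:
  fixes n k :: nat and t :: real
  assumes k: "1 \<le> k" "k < n" and t: "0 \<le> t"
  defines "\<tau> \<equiv> real k * (t - crit_time n k)"
  shows "\<bar>real k * measure_pmf.expectation (interchange_law n t) (\<lambda>\<sigma>. real (cycle_count n k \<sigma>))
      - (if t > crit_time n k then 1 else 0)\<bar>
    \<le> (real n / real k + exp 1) * exp (- (real n - real k) * (\<tau> - 1 + exp (- \<tau>)))"
proof -
  define m where "m = n - k"
  define q where "q = exp (- (real k * t))"
  define Q where "Q = real m / (real n - 1)"
  define s where "s = exp \<tau>"
  define b where "b N r = real (N choose r) * q ^ r * (1 - q) ^ (N - r)" for N r
  define D where "D = exp (- (real n - real k) * (\<tau> - 1 + exp (- \<tau>)))"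
  have m: "real m = real n - real k" "0 < m" "m \<le> n" using k by (auto simp: m_def of_nat_diff)
  have n1: "real n - 1 > 0" using k by linarith
  have Q: "Q = exp (- (real k * crit_time n k))" using exp_crit_time[OF k] by (simp add: Q_def m)
  have qs: "q * s = Q" unfolding q_def s_def Q \<tau>_def by (simp add: algebra_simps flip: exp_add)
  have q: "0 < q" "q \<le> 1" using t by (auto simp: q_def)
  have s: "0 < s" by (simp add: s_def)
  have Q01: "0 < Q" "Q \<le> 1" using k n1 m unfolding Q_def by (auto simp: divide_simps)
  have b0: "0 \<le> b N r" for N r using q by (simp add: b_def)
  have qQ: "q = Q * exp (- \<tau>)" using qs by (simp add: s_def exp_minus field_simps)
  have D: "D = exp (real m * (1 - exp (- \<tau>))) / s ^ m"
    unfolding D_def s_def m(1)[symmetric]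
    by (simp add: exp_of_nat_mult[symmetric] algebra_simps flip: exp_diff)
  have mQ: "(real n - 1) * Q = real m" using n1 by (simp add: Q_def)
  have n1exp: "exp ((real n - 1) * (q * s - q)) / s ^ m = D"
  proof -
    have "(real n - 1) * (q * s - q) = (real n - 1) * Q * (1 - exp (- \<tau>))"
      unfolding qs using qQ by (simp add: right_diff_distrib mult.assoc)
    then show ?thesis unfolding mQ D by simp
  qed
  \<comment> \<open>With n trials the same tilt costs one more factor exp (Q - q), at most
    e.\<close>
  have tail: "sum (b n) A \<le> exp 1 * D" if "A \<subseteq> {..n}" "\<And>r. r \<in> A \<Longrightarrow> s ^ m \<le> s ^ r" for A
  proof -
    have "s ^ m * sum (b n) A \<le> exp (real n * (q * s - q))"
      unfolding b_def using q by (intro binomial_tail_le s that) auto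
    also have "real n * (q * s - q) = (real n - 1) * (q * s - q) + (q * s - q)" by (simp add: algebra_simps)
    also have "exp \<dots> \<le> exp ((real n - 1) * (q * s - q)) * exp 1"
      unfolding exp_add qs using Q01 q by (intro mult_left_mono) auto
    finally show ?thesis using s unfolding n1exp[symmetric] by (simp add: field_simps)
  qed
  have peak: "real (n choose m) * q ^ (m + 1) * (1 - q) ^ (k - 1) \<le> real n / real k * D"
  proof -
    \<comment> \<open>Absorption turns the isolated term into q n / k times a point probability for
      n - 1 trials.\<close>
    have "k * (n choose m) = n * ((n - 1) choose m)"
      using binomial_absorb_comp[of n m] k by (simp add: m_def)
    then have "real (n choose m) = real n / real k * real ((n - 1) choose m)"
      using k by (simp add: field_simps flip: of_nat_mult)
    then have "real (n choose m) * q ^ (m + 1) * (1 - q) ^ (k - 1) = q * (real n / real k * b (n - 1) m)"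
      using k by (simp add: b_def m_def mult_ac)
    also have "\<dots> \<le> 1 * (real n / real k * b (n - 1) m)"
      using q b0 by (intro mult_right_mono) auto
    also have "\<dots> \<le> real n / real k * D"
    proof -
      have "s ^ m * b (n - 1) m \<le> exp ((real n - 1) * (q * s - q))"
        using binomial_tail_le[of q s "{m}" "n - 1" m] q s k
        by (simp add: b_def m_def of_nat_diff)
      then have "b (n - 1) m \<le> D" using s unfolding n1exp[symmetric] by (simp add: field_simps)
      then show ?thesis by (simp add: mult_left_mono divide_right_mono)
    qed
    finally show ?thesis .
  qed
  have peak0: "0 \<le> real (n choose m) * q ^ (m + 1) * (1 - q) ^ (k - 1)" using q by simp
  have E: "real k * measure_pmf.expectation (interchange_law n t) (\<lambda>\<sigma>. real (cycle_count n k \<sigma>)) =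
      real (n choose m) * q ^ (m + 1) * (1 - q) ^ (k - 1) + sum (b n) {..m}"
    using expectation_cycle_count[of k n t] k t unfolding m_def q_def b_def by simp
  have D0: "0 < D" by (simp add: D_def)
  have nkD: "0 \<le> real n / real k * D" "0 \<le> exp 1 * D" using D0 by simp_all
  show ?thesis
  proof (cases "t > crit_time n k")
    case True
    \<comment> \<open>After the critical time \<open>s\<close> exceeds 1 and controls the upper
      tail, so the lower one is close to 1; before it \<open>s\<close> is at most 1 and the lower
      tail itself is small.\<close>
    then have "1 < s" using k by (simp add: s_def \<tau>_def)
    then have up: "sum (b n) {m<..n} \<le> exp 1 * D" by (intro tail) auto
    have "1 = sum (b n) {..n}" using binomial_ring[of q "1 - q" n] by (simp add: b_def)
    also have "\<dots> = sum (b n) ({..m} \<union> {m<..n})" using m(3) by (intro sum.cong) auto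
    also have "\<dots> = sum (b n) {..m} + sum (b n) {m<..n}" by (rule sum.union_disjoint) auto
    finally have "sum (b n) {..m} = 1 - sum (b n) {m<..n}" by simp
    moreover have "0 \<le> sum (b n) {m<..n}" using b0 by (simp add: sum_nonneg)
    ultimately show ?thesis
      using True up peak peak0 nkD unfolding E D_def[symmetric] distrib_right by simp
  next
    case False
    then have "s \<le> 1" using k by (simp add: s_def \<tau>_def mult_nonneg_nonpos)
    then have "sum (b n) {..m} \<le> exp 1 * D"
      using m(3) s by (intro tail) (auto intro: power_decreasing)
    moreover have "0 \<le> sum (b n) {..m}" using b0 by (simp add: sum_nonneg)
    ultimately show ?thesis
      using False peak peak0 unfolding E D_def[symmetric] distrib_right by simp
  qed
qed

theorem theorem2:
  shows "\<exists>c C :: real. 0 < c \<and> 0 < C \<and>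
    (\<forall>(n :: nat) (k :: nat) (t :: real). 1 \<le> k \<longrightarrow> k < n \<longrightarrow> 0 \<le> t \<longrightarrow>
      \<bar>measure_pmf.expectation (interchange_law n t) (\<lambda>\<sigma>. real (cycle_count n k \<sigma>))
         - 1 / real k * (if t > crit_time n k then 1 else 0)\<bar>
      \<le> C * (real n powr (3 / 2) * real k powr (- (3 / 2)) * (real n - real k) powr (- (1 / 2)))
          * exp (- c * (real n - real k) * min (\<bar>t - crit_time n k\<bar>\<^sup>2 * (real k)\<^sup>2) 1))"
proof (rule exI[of _ "1 / 4"], rule exI[of _ "1 + exp 1"], intro conjI allI impI)
  \<comment> \<open>The rate is that of \<open>exp_minus_lower\<close>. In the tail bound, dividing
    by k leaves n / k^2 and e / k, and both n / k^2 and 1 / k are at most \<open>q\<close>; this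
    gives 1 + e.\<close>
  show "0 < (1 / 4 :: real)" "0 < (1 + exp 1 :: real)" by (simp_all add: add_pos_pos)
  fix n k :: nat and t :: real
  assume k: "1 \<le> k" "k < n" and t: "0 \<le> t"
  define E where "E = measure_pmf.expectation (interchange_law n t) (\<lambda>\<sigma>. real (cycle_count n k \<sigma>))"
  define I where "I = (if t > crit_time n k then 1 else 0 :: real)"
  define \<tau> where "\<tau> = real k * (t - crit_time n k)"
  define M where "M = min (\<bar>t - crit_time n k\<bar>\<^sup>2 * (real k)\<^sup>2) 1"
  define q where "q = real n powr (3 / 2) * real k powr (- (3 / 2)) * (real n - real k) powr (- (1 / 2))"
  have m: "0 < real n - real k" "real n - real k \<le> real n" and k1: "1 \<le> real k" using k by auto
  have "M = min (\<tau>\<^sup>2) 1" by (simp add: M_def \<tau>_def power_mult_distrib mult.commute)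
  then have "(real n - real k) * (M / 4) \<le> (real n - real k) * (\<tau> - 1 + exp (- \<tau>))"
    using exp_minus_lower[of \<tau>] m by (intro mult_left_mono) auto
  moreover have "exp (- a * b) \<le> exp (- (1 / 4) * a * c)" if "a * (c / 4) \<le> a * b" for a b c :: real
    using that by simp
  ultimately have expo: "exp (- (real n - real k) * (\<tau> - 1 + exp (- \<tau>))) \<le> exp (- (1 / 4) * (real n - real k) * M)"
    by blast
  \<comment> \<open>The surplus of \<open>q\<close> over n / k^2 is k^(1/2) (n / (n - k))^(1/2), a
    product of factors at least 1.\<close>
  have nkq: "real n / (real k)\<^sup>2 \<le> q"
  proof -
    have n: "real n powr (3 / 2) = real n * real n powr (1 / 2)"
      using powr_add[of "real n" 1 "1 / 2"] k by simp
    have kk: "real k powr (- (3 / 2)) \<ge> real k powr (- 2)" using k1 by (intro powr_mono) auto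
    have "1 = real n powr (1 / 2) * real n powr (- (1 / 2))"
      using k by (simp flip: powr_add)
    also have "\<dots> \<le> real n powr (1 / 2) * (real n - real k) powr (- (1 / 2))"
      using m by (intro mult_left_mono powr_mono2') auto
    finally have one: "1 \<le> real n powr (1 / 2) * (real n - real k) powr (- (1 / 2))" .
    have "real n / (real k)\<^sup>2 = real n * real k powr (- 2) * 1"
      using k1 by (simp add: powr_minus powr_numeral divide_inverse)
    also have "\<dots> \<le> real n * real k powr (- (3 / 2)) * (real n powr (1 / 2) * (real n - real k) powr (- (1 / 2)))"
      using kk one by (intro mult_mono) auto
    also have "\<dots> = q" unfolding q_def n by (simp add: mult_ac)
    finally show ?thesis .
  qed
  have "1 / real k \<le> real n / (real k)\<^sup>2"
    using k k1 by (simp add: power2_eq_square field_simps)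
  then have oneq: "1 / real k \<le> q" using nkq by linarith
  have "E - 1 / real k * I = (real k * E - I) / real k"
    using k1 by (simp add: field_simps)
  then have "\<bar>E - 1 / real k * I\<bar> = \<bar>real k * E - I\<bar> / real k" by simp
  also have "\<dots> \<le> (real n / real k + exp 1) * exp (- (real n - real k) * (\<tau> - 1 + exp (- \<tau>))) / real k"
    unfolding E_def I_def \<tau>_def using cycle_count_tail[OF k t] by (intro divide_right_mono) auto
  also have "\<dots> = (real n / (real k)\<^sup>2 + exp 1 * (1 / real k)) * exp (- (real n - real k) * (\<tau> - 1 + exp (- \<tau>)))"
    using k1 by (simp add: power2_eq_square field_simps)
  also have "\<dots> \<le> (q + exp 1 * q) * exp (- (1 / 4) * (real n - real k) * M)"
  proof (rule mult_mono)
    show "real n / (real k)\<^sup>2 + exp 1 * (1 / real k) \<le> q + exp 1 * q"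
      using nkq oneq by (intro add_mono mult_left_mono) auto
    have "0 \<le> q" by (simp add: q_def)
    then show "0 \<le> q + exp 1 * q" by simp
  qed (use expo in auto)
  also have "\<dots> = (1 + exp 1) * q * exp (- (1 / 4) * (real n - real k) * M)" by (simp add: algebra_simps)
  finally show "\<bar>E - 1 / real k * I\<bar> \<le> (1 + exp 1) * q * exp (- (1 / 4) * (real n - real k) * M)" .
qed

end
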